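(* Let $n\ge2$, $N=2n-1$, and let $[p_0:\cdots:p_N]$ be homogeneous coordinates on $\mathbb{P}^N$. Let $F_r=\sum_{j=0}^r(-1)^jp_{r-j}p_{N-r+j}$ for $1\le r\le n-1$, let $H_N=p_0p_N\prod_{r=1}^{n-1}F_r$, and let $\omega=(0^2,1^2,\dots,N^2)$. Then $p_rp_{N-r}$ is the unique $\omega$-initial (minimal weight) monomial of $F_r$ for each $1\le r\le n-1$, and $$\operatorname{in}_\omega(H_N)=\prod_{i=0}^Np_i.$$ Moreover, the family $$H_{N,t}=p_0p_N\prod_{r=1}^{n-1}\Bigl(p_rp_{N-r}+\sum_{j=1}^r(-1)^jt^{2j(N-2r+j)}p_{r-j}p_{N-r+j}\Bigr)$$ satisfies $H_{N,1}=H_N$ and $H_{N,0}=\prod_{i=0}^Np_i$, and $\mathbb{C}[p_0,\dots,p_N,t]/(H_{N,t})$ is flat over $\mathbb{C}[t]$. Hence $\{H_{N,t}=0\}\subset\mathbb{P}^N\times\mathbb{A}^1$ gives a flat degeneration of pairs $$(\mathbb{P}^{2n-1},D_C)\rightsquigarrow(\mathbb{P}^{2n-1},D_{\mathrm{tor}})$$ with fixed ambient variety, where $D_C=\{H_N=0\}$ and $D_{\mathrm{tor}}=\{\prod_{i=0}^Np_i=0\}$.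
   Context: Work over $\mathbb{C}$. The $\omega$-weight of a monomial $p^\alpha$ is $\omega\cdot\alpha=\sum_i i^2\alpha_i$; the weight of a polynomial is the minimum weight of its monomials, and $\operatorname{in}_\omega(f)$ is the sum of the terms of $f$ of minimal weight. The notation $(X,D_1)\rightsquigarrow(X,D_0)$ means a family of divisors in $X$, flat over $\mathbb{A}^1$, whose fibre over $t=1$ is $D_1$ and whose fibre over $t=0$ is $D_0$. *)

theory Defs
  imports
    "HOL-Library.Poly_Mapping"
    "HOL-Library.FuncSet"
    "HOL-Computational_Algebra.Polynomial"
    "HOL-Algebra.Module"
    "HOL-Algebra.QuotRing"
    "HOL-Algebra.Free_Abelian_Groups"
    "HOL-Algebra.Algebraic_Closure_Type"
begin

section \<open>Multivariate polynomials and initial forms\<close>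

text \<open>
  A polynomial in variables \<open>p\<^sub>0, p\<^sub>1, \<dots>\<close> with coefficients in \<open>'k\<close> is a finitely supported
  map from exponent vectors to coefficients; sums and products are those of \<open>Poly_Mapping\<close>.
  The ring \<open>\<complex>[p\<^sub>0, \<dots>, p\<^sub>N, t]\<close> is taken as \<open>\<complex>[t][p\<^sub>0, \<dots>, p\<^sub>N]\<close>, i.e. \<open>'k = complex poly\<close>.
\<close>

type_synonym exponent = "nat \<Rightarrow>\<^sub>0 nat"
type_synonym 'k mpol = "exponent \<Rightarrow>\<^sub>0 'k"

definition pvar :: "nat \<Rightarrow> 'k::comm_ring_1 mpol" where
  "pvar i = Poly_Mapping.single (Poly_Mapping.single i 1) 1"

definition const :: "'k \<Rightarrow> 'k::comm_ring_1 mpol" where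
  "const c = Poly_Mapping.single 0 c"

definition weight :: "(nat \<Rightarrow> nat) \<Rightarrow> exponent \<Rightarrow> nat" where
  "weight \<omega> \<alpha> = (\<Sum>i\<in>Poly_Mapping.keys \<alpha>. \<omega> i * Poly_Mapping.lookup \<alpha> i)"

text \<open>Only meaningful for nonzero polynomials (\<open>Min\<close> of the empty set is unspecified).\<close>

definition poly_weight :: "(nat \<Rightarrow> nat) \<Rightarrow> 'k::zero mpol \<Rightarrow> nat" where
  "poly_weight \<omega> f = Min (weight \<omega> ` Poly_Mapping.keys f)"

definition initial_monomials :: "(nat \<Rightarrow> nat) \<Rightarrow> 'k::zero mpol \<Rightarrow> exponent set" where
  "initial_monomials \<omega> f = {\<alpha> \<in> Poly_Mapping.keys f. weight \<omega> \<alpha> = poly_weight \<omega> f}"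

definition initial_form :: "(nat \<Rightarrow> nat) \<Rightarrow> 'k::comm_ring_1 mpol \<Rightarrow> 'k mpol" where
  "initial_form \<omega> f =
     (\<Sum>\<alpha>\<in>initial_monomials \<omega> f. Poly_Mapping.single \<alpha> (Poly_Mapping.lookup f \<alpha>))"

definition homogeneous :: "nat \<Rightarrow> 'k::zero mpol \<Rightarrow> bool" where
  "homogeneous d f \<longleftrightarrow>
     (\<forall>\<alpha>\<in>Poly_Mapping.keys f. (\<Sum>i\<in>Poly_Mapping.keys \<alpha>. Poly_Mapping.lookup \<alpha> i) = d)"

definition mpol_ring :: "nat set \<Rightarrow> 'k::comm_ring_1 mpol ring" where
  "mpol_ring V =
     \<lparr>carrier = {f. \<forall>\<alpha>\<in>Poly_Mapping.keys f. Poly_Mapping.keys \<alpha> \<subseteq> V},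
      monoid.mult = (*), one = 1, zero = 0, add = (+)\<rparr>"

definition specialize :: "complex \<Rightarrow> complex poly mpol \<Rightarrow> complex mpol" where
  "specialize c f = Poly_Mapping.map (\<lambda>q. poly q c) f"


section \<open>Tensor products and flat modules\<close>

definition tensor_relations ::
  "('r, 'x) ring_scheme \<Rightarrow> ('r, 'm) module \<Rightarrow> ('r, 'a) module \<Rightarrow> (('m \<times> 'a) \<Rightarrow>\<^sub>0 int) set" where
  "tensor_relations R M A =
     {frag_of (x \<oplus>\<^bsub>M\<^esub> y, a) - frag_of (x, a) - frag_of (y, a) | x y a.
        x \<in> carrier M \<and> y \<in> carrier M \<and> a \<in> carrier A} \<union>
     {frag_of (x, a \<oplus>\<^bsub>A\<^esub> b) - frag_of (x, a) - frag_of (x, b) | x a b.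
        x \<in> carrier M \<and> a \<in> carrier A \<and> b \<in> carrier A} \<union>
     {frag_of (r \<odot>\<^bsub>M\<^esub> x, a) - frag_of (x, r \<odot>\<^bsub>A\<^esub> a) | r x a.
        r \<in> carrier R \<and> x \<in> carrier M \<and> a \<in> carrier A}"

definition tensor_kernel ::
  "('r, 'x) ring_scheme \<Rightarrow> ('r, 'm) module \<Rightarrow> ('r, 'a) module \<Rightarrow> (('m \<times> 'a) \<Rightarrow>\<^sub>0 int) set" where
  "tensor_kernel R M A =
     generate (free_Abelian_group (carrier M \<times> carrier A)) (tensor_relations R M A)"

text \<open>The underlying abelian group of \<open>M \<otimes>\<^sub>R A\<close>, which is all that injectivity depends on.\<close>

definition tensor ::
  "('r, 'x) ring_scheme \<Rightarrow> ('r, 'm) module \<Rightarrow> ('r, 'a) module \<Rightarrow> (('m \<times> 'a) \<Rightarrow>\<^sub>0 int) set monoid" where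
  "tensor R M A = free_Abelian_group (carrier M \<times> carrier A) Mod tensor_kernel R M A"

definition linear_maps ::
  "('r, 'x) ring_scheme \<Rightarrow> ('r, 'a) module \<Rightarrow> ('r, 'b) module \<Rightarrow> ('a \<Rightarrow> 'b) set" where
  "linear_maps R A B =
     {f \<in> carrier A \<rightarrow> carrier B.
        (\<forall>x\<in>carrier A. \<forall>y\<in>carrier A. f (x \<oplus>\<^bsub>A\<^esub> y) = f x \<oplus>\<^bsub>B\<^esub> f y) \<and>
        (\<forall>r\<in>carrier R. \<forall>x\<in>carrier A. f (r \<odot>\<^bsub>A\<^esub> x) = r \<odot>\<^bsub>B\<^esub> f x)}"

text \<open>
  The map \<open>id \<otimes> f : M \<otimes>\<^sub>R A \<rightarrow> M \<otimes>\<^sub>R B\<close>: the set product with the kernel saturates the image of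
  a coset \<open>C\<close> to the coset of \<open>M \<otimes>\<^sub>R B\<close> containing it.
\<close>

definition tensor_map ::
  "('r, 'x) ring_scheme \<Rightarrow> ('r, 'm) module \<Rightarrow> ('r, 'b) module \<Rightarrow> ('a \<Rightarrow> 'b)
     \<Rightarrow> (('m \<times> 'a) \<Rightarrow>\<^sub>0 int) set \<Rightarrow> (('m \<times> 'b) \<Rightarrow>\<^sub>0 int) set" where
  "tensor_map R M B f C =
     tensor_kernel R M B <#>\<^bsub>free_Abelian_group (carrier M \<times> carrier B)\<^esub>
       (frag_extend (\<lambda>(x, a). frag_of (x, f a)) ` C)"

text \<open>
  \<open>M\<close> is flat if \<open>M \<otimes>\<^sub>R _\<close> preserves injectivity of linear maps \<open>A \<rightarrow> B\<close>. A HOL definition cannot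
  quantify over types, so the types of the elements of \<open>A\<close> and \<open>B\<close> are parameters; a theorem
  in which \<open>'a\<close> and \<open>'b\<close> are free type variables asserts this for modules on arbitrary types.
\<close>

definition flat_module ::
  "'a itself \<Rightarrow> 'b itself \<Rightarrow> ('r, 'x) ring_scheme \<Rightarrow> ('r, 'm) module \<Rightarrow> bool" where
  "flat_module _ _ R M \<longleftrightarrow>
     module R M \<and>
     (\<forall>(A :: ('r, 'a) module) (B :: ('r, 'b) module) f.
        module R A \<and> module R B \<and> f \<in> linear_maps R A B \<and> inj_on f (carrier A) \<longrightarrow>
        inj_on (tensor_map R M B f) (carrier (tensor R M A)))"

text \<open>\<open>K[p\<^sub>v : v \<in> V] / I\<close> as a module over its coefficient ring \<open>K\<close>.\<close>

definition quotient_module ::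
  "nat set \<Rightarrow> 'k::comm_ring_1 mpol set \<Rightarrow> ('k, 'k mpol set) module" where
  "quotient_module V I =
     (let Q = mpol_ring V Quot I in
      \<lparr>carrier = carrier Q, monoid.mult = monoid.mult Q, one = one Q, zero = zero Q, add = add Q,
       module.smult = (\<lambda>c x. (I +>\<^bsub>mpol_ring V\<^esub> const c) \<otimes>\<^bsub>Q\<^esub> x)\<rparr>)"


section \<open>Divisors on projective space and flat degenerations\<close>

text \<open>
  A closed subscheme of \<open>\<P>\<^sup>N\<close> over the coefficient ring \<open>K\<close> is given by its ideals on the standard
  affine charts \<open>p\<^sub>i \<noteq> 0\<close>, with coordinate ring \<open>K[p\<^sub>j : j \<le> N, j \<noteq> i]\<close>, where \<open>p\<^sub>j\<close> stands for
  \<open>p\<^sub>j / p\<^sub>i\<close>. For \<open>K = \<complex>\<close> this is \<open>\<P>\<^sup>N\<close>, and for \<open>K = \<complex>[t]\<close> it is \<open>\<P>\<^sup>N \<times> \<A>\<^sup>1\<close>.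
\<close>

type_synonym 'k subscheme = "nat \<Rightarrow> 'k mpol set"

definition chart_vars :: "nat \<Rightarrow> nat \<Rightarrow> nat set" where
  "chart_vars N i = {..N} - {i}"

text \<open>Setting \<open>p\<^sub>i = 1\<close>.\<close>

definition dehomogenize :: "nat \<Rightarrow> 'k::comm_ring_1 mpol \<Rightarrow> 'k mpol" where
  "dehomogenize i f =
     (\<Sum>\<alpha>\<in>Poly_Mapping.keys f.
        Poly_Mapping.single (Poly_Mapping.update i 0 \<alpha>) (Poly_Mapping.lookup f \<alpha>))"

definition hypersurface :: "nat \<Rightarrow> 'k::comm_ring_1 mpol \<Rightarrow> 'k subscheme" where
  "hypersurface N f = (\<lambda>i\<in>{..N}. PIdl\<^bsub>mpol_ring (chart_vars N i)\<^esub> (dehomogenize i f))"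

text \<open>
  For \<open>K = \<complex>\<close> and \<open>K = \<complex>[t]\<close> the Picard group of \<open>\<P>\<^sup>N\<close> over \<open>K\<close> is generated by \<open>\<O>(1)\<close>, so
  that the effective (Cartier) divisors are the zero schemes of nonzero forms in the \<open>p\<^sub>i\<close>.
\<close>

definition effective_divisor :: "nat \<Rightarrow> 'k::comm_ring_1 subscheme \<Rightarrow> bool" where
  "effective_divisor N D \<longleftrightarrow>
     (\<exists>f d. f \<in> carrier (mpol_ring {..N}) \<and> f \<noteq> 0 \<and> homogeneous d f \<and> D = hypersurface N f)"

text \<open>
  The scheme-theoretic fibre over \<open>t = c\<close>: specialization is surjective on each chart, so the
  image of an ideal is the ideal of the fibre.
\<close>

definition fibre :: "nat \<Rightarrow> complex \<Rightarrow> complex poly subscheme \<Rightarrow> complex subscheme" where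
  "fibre N c Y = (\<lambda>i\<in>{..N}. specialize c ` Y i)"

abbreviation Ct :: "complex poly ring" where
  "Ct \<equiv> ring_of_type_algebra"

text \<open>Flatness over \<open>\<A>\<^sup>1\<close> of a closed subscheme of \<open>\<P>\<^sup>N \<times> \<A>\<^sup>1\<close> is flatness of its charts.\<close>

definition flat_over_line ::
  "'a itself \<Rightarrow> 'b itself \<Rightarrow> nat \<Rightarrow> complex poly subscheme \<Rightarrow> bool" where
  "flat_over_line A B N Y \<longleftrightarrow>
     (\<forall>i\<le>N. flat_module A B Ct (quotient_module (chart_vars N i) (Y i)))"

text \<open>
  \<open>Y \<subseteq> \<P>\<^sup>N \<times> \<A>\<^sup>1\<close> exhibits \<open>(\<P>\<^sup>N, D\<^sub>1) \<leadsto> (\<P>\<^sup>N, D\<^sub>0)\<close>.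
\<close>

definition flat_degeneration ::
  "'a itself \<Rightarrow> 'b itself \<Rightarrow> nat \<Rightarrow> complex poly subscheme
     \<Rightarrow> complex subscheme \<Rightarrow> complex subscheme \<Rightarrow> bool" where
  "flat_degeneration A B N Y D1 D0 \<longleftrightarrow>
     effective_divisor N Y \<and>
     (\<forall>c. effective_divisor N (fibre N c Y)) \<and>
     flat_over_line A B N Y \<and>
     fibre N 1 Y = D1 \<and>
     fibre N 0 Y = D0"


section \<open>The polynomials of the degeneration\<close>

definition F :: "nat \<Rightarrow> nat \<Rightarrow> complex mpol" where
  "F N r = (\<Sum>j=0..r. (-1) ^ j * pvar (r - j) * pvar (N - r + j))"

definition H :: "nat \<Rightarrow> complex mpol" where
  "H n = (let N = 2 * n - 1 in pvar 0 * pvar N * (\<Prod>r=1..n-1. F N r))"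

definition H_family :: "nat \<Rightarrow> complex poly mpol" where
  "H_family n = (let N = 2 * n - 1 in
     pvar 0 * pvar N *
     (\<Prod>r=1..n-1. pvar r * pvar (N - r) +
        (\<Sum>j=1..r. (-1) ^ j * const ([:0, 1:] ^ (2 * j * (N - 2 * r + j))) *
                     pvar (r - j) * pvar (N - r + j))))"

end

(*
  Let s_r = w_r + w_(N-r) for weights w on the variables. As soon as s is strictly increasing on
  0..n-1, the monomial p_r p_(N-r) has the largest weight in F_r, so the product of all variables is
  the leading monomial of H_(N,t), with coefficient 1. Division with remainder by H_(N,t) then shows
  that the quotient ring is a free module over C[t], hence flat. On the chart p_i = 1 one needs
  nonnegative weights with w_i = 0; they exist, because each s_r may be distributed arbitrarily over
  the pair p_r, p_(N-r).
*)
theory Submission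
  imports Defs
begin

section \<open>Polynomial rings\<close>

text \<open>The \<omega>-weights decide the initial forms but cannot drive the division. They would
  have to be reversed, because the wanted monomial is minimal for \<omega>, and made to vanish at i.
  This forces w_j = i^2 - j^2, which is negative for j > i, so that the division need not stop.
  Setting p_i = 1 destroys homogeneity, hence no shift by a multiple of the degree can repair this,
  and each chart gets a weight of its own. A weight that isolates one monomial takes the place of a
  monomial order; ties among the other monomials are harmless. As the isolated coefficient is 1, the
  arguments work over every commutative ring and for arbitrary coefficients of the other terms,
  which covers H_N, the family and all its fibres at once. Flatness concerns tensor products
  presented as quotients of free abelian groups. It is obtained by comparing coordinates of tensors,
  without passing through direct sums.\<close>

lemma carrier_mpol_ring: "f \<in> carrier (mpol_ring V) \<longleftrightarrow> (\<forall>\<alpha>\<in>Poly_Mapping.keys f. Poly_Mapping.keys \<alpha> \<subseteq> V)"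
  by (simp add: mpol_ring_def)

lemma mpol_ring_simps [simp]:
  "monoid.mult (mpol_ring V) = (*)" "one (mpol_ring V) = 1"
  "zero (mpol_ring V) = 0" "add (mpol_ring V) = (+)"
  by (simp_all add: mpol_ring_def)

lemma keys_exponent_add:
  "Poly_Mapping.keys (\<alpha> + \<beta> :: exponent) = Poly_Mapping.keys \<alpha> \<union> Poly_Mapping.keys \<beta>"
  by (auto simp: in_keys_iff lookup_add)

lemma mpol_ring_closed [simp, intro]:
  "0 \<in> carrier (mpol_ring V)"
  "1 \<in> carrier (mpol_ring V)"
  "f \<in> carrier (mpol_ring V) \<Longrightarrow> g \<in> carrier (mpol_ring V) \<Longrightarrow> f + g \<in> carrier (mpol_ring V)"
  "f \<in> carrier (mpol_ring V) \<Longrightarrow> g \<in> carrier (mpol_ring V) \<Longrightarrow> f - g \<in> carrier (mpol_ring V)"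
  "f \<in> carrier (mpol_ring V) \<Longrightarrow> - f \<in> carrier (mpol_ring V)"
  "f \<in> carrier (mpol_ring V) \<Longrightarrow> g \<in> carrier (mpol_ring V) \<Longrightarrow> f * g \<in> carrier (mpol_ring V)"
  "const c \<in> carrier (mpol_ring V)"
  "i \<in> V \<Longrightarrow> pvar i \<in> carrier (mpol_ring V)"
  "Poly_Mapping.keys \<alpha> \<subseteq> V \<Longrightarrow> Poly_Mapping.single \<alpha> c \<in> carrier (mpol_ring V)"
proof -
  show "f * g \<in> carrier (mpol_ring V)"
    if "f \<in> carrier (mpol_ring V)" "g \<in> carrier (mpol_ring V)"
    using that keys_mult[of f g] unfolding carrier_mpol_ring by (fastforce simp: keys_exponent_add)
  show "f + g \<in> carrier (mpol_ring V)"
    if "f \<in> carrier (mpol_ring V)" "g \<in> carrier (mpol_ring V)"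
    using that keys_add[of f g] unfolding carrier_mpol_ring by blast
  show "f - g \<in> carrier (mpol_ring V)"
    if "f \<in> carrier (mpol_ring V)" "g \<in> carrier (mpol_ring V)"
    using that keys_diff[of f g] unfolding carrier_mpol_ring by blast
qed (auto simp: carrier_mpol_ring const_def pvar_def in_keys_iff lookup_add lookup_minus lookup_single when_def
  split: if_splits)

lemma mpol_ring_sum [intro]:
  "(\<And>i. i \<in> I \<Longrightarrow> f i \<in> carrier (mpol_ring V)) \<Longrightarrow> sum f I \<in> carrier (mpol_ring V)"
  by (induction I rule: infinite_finite_induct) auto

lemma mpol_ring_prod [intro]:
  "(\<And>i. i \<in> I \<Longrightarrow> f i \<in> carrier (mpol_ring V)) \<Longrightarrow> prod f I \<in> carrier (mpol_ring V)"
  by (induction I rule: infinite_finite_induct) auto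

lemma cring_mpol_ring: "cring (mpol_ring V :: 'k::comm_ring_1 mpol ring)"
proof (rule cringI)
  show "abelian_group (mpol_ring V :: 'k mpol ring)"
  proof (rule abelian_groupI)
    fix x :: "'k mpol"
    assume "x \<in> carrier (mpol_ring V)"
    then show "\<exists>y\<in>carrier (mpol_ring V). y \<oplus>\<^bsub>mpol_ring V\<^esub> x = \<zero>\<^bsub>mpol_ring V\<^esub>"
      by (intro bexI[of _ "-x"]) auto
  qed (auto simp: algebra_simps)
  show "Group.comm_monoid (mpol_ring V :: 'k mpol ring)"
    by (rule comm_monoidI) (auto simp: algebra_simps)
qed (auto simp: algebra_simps)

lemma mpol_eq_sum_single:
  fixes f :: "'k::comm_ring_1 mpol"
  assumes "finite A" "Poly_Mapping.keys f \<subseteq> A"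
  shows "f = (\<Sum>\<alpha>\<in>A. Poly_Mapping.single \<alpha> (Poly_Mapping.lookup f \<alpha>))"
  using assms
  by (intro poly_mapping_eqI) (auto simp: lookup_sum lookup_single when_def in_keys_iff)

text \<open>The index sets may exceed the supports: specialization can kill coefficients, and
  \<open>specialize_mult\<close> has to compare two products over the same exponents.\<close>

lemma lookup_times:
  fixes f g :: "'k::comm_ring_1 mpol"
  assumes "finite A" "Poly_Mapping.keys f \<subseteq> A" "finite B" "Poly_Mapping.keys g \<subseteq> B"
  shows "Poly_Mapping.lookup (f * g) \<gamma> =
    (\<Sum>\<alpha>\<in>A. \<Sum>\<beta>\<in>B. if \<alpha> + \<beta> = \<gamma> then Poly_Mapping.lookup f \<alpha> * Poly_Mapping.lookup g \<beta> else 0)"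
proof -
  have "f * g = (\<Sum>\<alpha>\<in>A. Poly_Mapping.single \<alpha> (Poly_Mapping.lookup f \<alpha>)) *
      (\<Sum>\<beta>\<in>B. Poly_Mapping.single \<beta> (Poly_Mapping.lookup g \<beta>))"
    using mpol_eq_sum_single[OF assms(1,2)] mpol_eq_sum_single[OF assms(3,4)] by simp
  then show ?thesis
    by (simp add: sum_product mult_single lookup_sum lookup_single when_def)
qed


section \<open>Leading monomials with unit coefficient\<close>

text \<open>Integer values of \<open>W\<close> allow \<open>W = - weight \<omega>\<close>, which turns \<open>\<omega>\<close>-initial monomials into leading ones.\<close>

definition leading :: "(exponent \<Rightarrow> int) \<Rightarrow> 'k::comm_ring_1 mpol \<Rightarrow> exponent \<Rightarrow> bool" where
  "leading W f m \<longleftrightarrow> Poly_Mapping.lookup f m = 1 \<and> (\<forall>\<alpha>\<in>Poly_Mapping.keys f. \<alpha> \<noteq> m \<longrightarrow> W \<alpha> < W m)"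

lemma leading_le: "leading W f m \<Longrightarrow> \<alpha> \<in> Poly_Mapping.keys f \<Longrightarrow> W \<alpha> \<le> W m"
  by (cases "\<alpha> = m") (auto simp: leading_def less_imp_le)

lemma leading_single: "leading W (Poly_Mapping.single m 1) m"
  by (auto simp: leading_def split: if_splits)

lemma leading_add:
  assumes "leading W f m" "\<And>\<alpha>. \<alpha> \<in> Poly_Mapping.keys g \<Longrightarrow> W \<alpha> < W m"
  shows "leading W (f + g) m"
proof -
  have "m \<notin> Poly_Mapping.keys g"
    using assms(2) by blast
  then show ?thesis
    using assms keys_add[of f g] unfolding leading_def by (auto simp: lookup_add not_in_keys_iff_lookup_eq_zero)
qed

text \<open>Since W \<beta> bounds the weights of f, two exponents with sum \<beta> + m leave weight
  at least W m for the member from g, and only m attains it. So a single product contributes and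
  nothing cancels. Ties in f are allowed: \<open>reduced_multiple_eq_0\<close> takes for \<beta>
  just one exponent of maximal weight.\<close>

lemma lookup_times_leading:
  fixes f g :: "'k::comm_ring_1 mpol"
  assumes W: "\<And>\<alpha> \<beta>. W (\<alpha> + \<beta>) = W \<alpha> + W \<beta>"
    and f: "\<And>\<alpha>. \<alpha> \<in> Poly_Mapping.keys f \<Longrightarrow> W \<alpha> \<le> W \<beta>"
    and g: "leading W g m"
  shows "Poly_Mapping.lookup (f * g) (\<beta> + m) = Poly_Mapping.lookup f \<beta>"
proof -
  have key: "\<alpha> + \<gamma> = \<beta> + m \<longleftrightarrow> \<gamma> = m \<and> \<alpha> = \<beta>"
    if "\<alpha> \<in> Poly_Mapping.keys f" "\<gamma> \<in> Poly_Mapping.keys g" for \<alpha> \<gamma>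
  proof
    assume eq: "\<alpha> + \<gamma> = \<beta> + m"
    have "W \<alpha> + W \<gamma> = W \<beta> + W m"
      using arg_cong[OF eq, of W] by (simp add: W)
    then have "\<gamma> = m"
      using f[OF that(1)] g that(2) by (force simp: leading_def)
    then show "\<gamma> = m \<and> \<alpha> = \<beta>"
      using eq by simp
  qed simp
  have "Poly_Mapping.lookup (f * g) (\<beta> + m) =
      (\<Sum>\<alpha>\<in>Poly_Mapping.keys f. \<Sum>\<gamma>\<in>Poly_Mapping.keys g.
        if \<gamma> = m then (if \<alpha> = \<beta> then Poly_Mapping.lookup f \<beta> * Poly_Mapping.lookup g m else 0) else 0)"
    unfolding lookup_times[OF finite_keys order_refl finite_keys order_refl] by (intro sum.cong refl) (auto simp: key)
  also have "\<dots> = Poly_Mapping.lookup f \<beta> * Poly_Mapping.lookup g m"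
    by (cases "m \<in> Poly_Mapping.keys g") (auto simp: in_keys_iff)
  finally show ?thesis
    using g by (simp add: leading_def)
qed

text \<open>A pair of exponents other than (k, m) loses weight in at least one member and gains in
  neither.\<close>

lemma leading_mult:
  assumes W: "\<And>\<alpha> \<beta>. W (\<alpha> + \<beta>) = W \<alpha> + W \<beta>"
    and f: "leading W f k" and g: "leading W g m"
  shows "leading W (f * g) (k + m)"
  unfolding leading_def
proof (intro conjI ballI impI)
  show "Poly_Mapping.lookup (f * g) (k + m) = 1"
    using lookup_times_leading[OF W leading_le[OF f] g] f by (simp add: leading_def)
next
  fix \<alpha> assume "\<alpha> \<in> Poly_Mapping.keys (f * g)" "\<alpha> \<noteq> k + m"
  then obtain a b where ab: "\<alpha> = a + b" "a \<in> Poly_Mapping.keys f" "b \<in> Poly_Mapping.keys g"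
    using keys_mult[of f g] by blast
  then have "a \<noteq> k \<or> b \<noteq> m"
    using \<open>\<alpha> \<noteq> k + m\<close> by auto
  then show "W \<alpha> < W (k + m)"
    using ab leading_le[OF f ab(2)] leading_le[OF g ab(3)] f g
    by (auto simp: leading_def W intro: add_less_le_mono add_le_less_mono)
qed

lemma leading_prod:
  fixes f :: "'i \<Rightarrow> 'k::comm_ring_1 mpol"
  assumes W: "\<And>\<alpha> \<beta>. W (\<alpha> + \<beta>) = W \<alpha> + W \<beta>"
    and "\<And>i. i \<in> I \<Longrightarrow> leading W (f i) (m i)"
  shows "leading W (prod f I) (sum m I)"
  using assms(2)
proof (induction I rule: infinite_finite_induct)
  case (insert i I)
  then show ?case by (simp add: leading_mult[OF W])
qed (simp_all add: leading_single flip: single_one)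

text \<open>As m occurs in f, the minimum in \<open>poly_weight\<close> is over a nonempty set; the
  reversed sign makes it the weight of m, and coefficient 1 leaves the bare monomial.\<close>

lemma leading_unique_extremum:
  assumes "leading (\<lambda>\<alpha>. - int (weight \<omega> \<alpha>)) f m"
  shows "initial_monomials \<omega> (f :: 'k::comm_ring_1 mpol) = {m}"
    and "initial_form \<omega> f = Poly_Mapping.single m 1"
proof -
  have m: "m \<in> Poly_Mapping.keys f"
    using assms by (simp add: leading_def in_keys_iff)
  have le: "weight \<omega> m \<le> weight \<omega> \<alpha>" if "\<alpha> \<in> Poly_Mapping.keys f" for \<alpha>
    using leading_le[OF assms(1) that] by simp
  have "poly_weight \<omega> f = weight \<omega> m"
    unfolding poly_weight_def using m le by (intro Min_eqI) auto
  then show *: "initial_monomials \<omega> f = {m}"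
    using m assms(1) by (auto simp: initial_monomials_def leading_def)
  show "initial_form \<omega> f = Poly_Mapping.single m 1"
    using assms(1) by (simp add: initial_form_def * leading_def)
qed


section \<open>Division with remainder\<close>

text \<open>Divisibility of one monomial by another is addition of exponents. Reduced polynomials
  are the combinations of standard monomials; they serve as normal forms modulo a polynomial with
  leading exponent m.\<close>

definition reduced :: "exponent \<Rightarrow> 'k::comm_ring_1 mpol \<Rightarrow> bool" where
  "reduced m r \<longleftrightarrow> (\<forall>\<alpha>\<in>Poly_Mapping.keys r. \<forall>\<beta>. \<alpha> \<noteq> \<beta> + m)"

lemma reduced_0 [simp]: "reduced m 0"
  by (simp add: reduced_def)

lemma reduced_add: "reduced m f \<Longrightarrow> reduced m g \<Longrightarrow> reduced m (f + g)"
  using keys_add[of f g] unfolding reduced_def by blast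

lemma reduced_diff: "reduced m f \<Longrightarrow> reduced m g \<Longrightarrow> reduced m (f - g)"
  using keys_diff[of f g] unfolding reduced_def by (auto simp: in_keys_iff lookup_minus)

lemma lookup_const_mult:
  "Poly_Mapping.lookup (const c * f) \<alpha> = c * Poly_Mapping.lookup (f :: 'k::comm_ring_1 mpol) \<alpha>"
  by (simp add: const_def lookup_times[of "{0}" _ "Poly_Mapping.keys f"] in_keys_iff)

lemma reduced_const_mult: "reduced m f \<Longrightarrow> reduced m (const c * f)"
  unfolding reduced_def by (metis in_keys_iff lookup_const_mult mult_zero_right)

text \<open>A term of h of maximal weight, multiplied by the leading monomial of g, survives in h *
  g and is divisible by that monomial. This gives uniqueness of remainders.\<close>

lemma reduced_multiple_eq_0:
  assumes W: "\<And>\<alpha> \<beta>. W (\<alpha> + \<beta>) = W \<alpha> + W \<beta>"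
    and g: "leading W g m" and "reduced m (h * g)"
  shows "h * g = 0"
proof (rule ccontr)
  assume "h * g \<noteq> 0"
  then have "Poly_Mapping.keys h \<noteq> {}"
    by auto
  then have "Max (W ` Poly_Mapping.keys h) \<in> W ` Poly_Mapping.keys h"
    by (intro Max_in) auto
  then obtain \<beta> where \<beta>: "\<beta> \<in> Poly_Mapping.keys h" "W \<beta> = Max (W ` Poly_Mapping.keys h)"
    by auto
  then have "Poly_Mapping.lookup (h * g) (\<beta> + m) = Poly_Mapping.lookup h \<beta>"
    by (intro lookup_times_leading[OF W _ g]) auto
  then have "\<beta> + m \<in> Poly_Mapping.keys (h * g)"
    using \<beta>(1) by (simp add: in_keys_iff)
  then show False
    using assms(3) by (auto simp: reduced_def)
qed

text \<open>A monomial divisible by the leading one is traded, by subtracting a multiple of g, for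
  terms of strictly smaller weight. Nonnegativity of W makes the induction on
  \<open>nat (W \<alpha>)\<close> well-founded; exponents of equal weight never have to be
  compared.\<close>

lemma division_exists:
  fixes f g :: "'k::comm_ring_1 mpol"
  assumes W: "\<And>\<alpha> \<beta>. W (\<alpha> + \<beta>) = W \<alpha> + W \<beta>" and pos: "\<And>\<alpha>. W \<alpha> \<ge> 0"
    and g: "leading W g m" "g \<in> carrier (mpol_ring V)"
    and f: "f \<in> carrier (mpol_ring V)"
  shows "\<exists>h\<in>carrier (mpol_ring V). \<exists>r\<in>carrier (mpol_ring V). reduced m r \<and> f = h * g + r"
proof -
  \<comment> \<open>The set D is closed under addition, so it suffices to divide single
    monomials.\<close>
  define D where "D = {f. \<exists>h\<in>carrier (mpol_ring V). \<exists>r\<in>carrier (mpol_ring V). reduced m r \<and> f = h * g + r}"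
  have DI: "h * g + r \<in> D" if "h \<in> carrier (mpol_ring V)" "r \<in> carrier (mpol_ring V)" "reduced m r" for h r
    using that unfolding D_def by blast
  have add: "x + y \<in> D" if "x \<in> D" "y \<in> D" for x y
  proof -
    obtain h r h' r' where
      "h \<in> carrier (mpol_ring V)" "r \<in> carrier (mpol_ring V)" "reduced m r" "x = h * g + r"
      "h' \<in> carrier (mpol_ring V)" "r' \<in> carrier (mpol_ring V)" "reduced m r'" "y = h' * g + r'"
      using \<open>x \<in> D\<close> \<open>y \<in> D\<close> unfolding D_def by blast
    then show ?thesis
      using DI[of "h + h'" "r + r'"] by (auto simp: algebra_simps reduced_add)
  qed
  have sum: "sum x I \<in> D" if "\<And>i. i \<in> I \<Longrightarrow> x i \<in> D" for x :: "exponent \<Rightarrow> 'k mpol" and I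
    using that DI[of 0 0] by (induction I rule: infinite_finite_induct) (auto intro: add)
  have single: "Poly_Mapping.single \<alpha> c \<in> D" if "Poly_Mapping.keys \<alpha> \<subseteq> V" for \<alpha> c
    using that
  proof (induction "nat (W \<alpha>)" arbitrary: \<alpha> c rule: less_induct)
    case less
    show ?case
    proof (cases "\<exists>\<beta>. \<alpha> = \<beta> + m")
      case False
      then have "reduced m (Poly_Mapping.single \<alpha> c)"
        by (auto simp: reduced_def split: if_splits)
      then show ?thesis
        using DI[of 0 "Poly_Mapping.single \<alpha> c"] less.prems by auto
    next
      case True
      then obtain \<beta> where \<alpha>: "\<alpha> = \<beta> + m" by blast
      define h where "h = Poly_Mapping.single \<beta> c"
      define r where "r = Poly_Mapping.single \<alpha> c - h * g"
      have h: "h \<in> carrier (mpol_ring V)"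
        using less.prems by (auto simp: h_def \<alpha> keys_exponent_add)
      have r: "r \<in> carrier (mpol_ring V)"
        using h g(2) less.prems by (auto simp: r_def)
      have "Poly_Mapping.lookup (h * g) \<alpha> = c"
        unfolding \<alpha> by (subst lookup_times_leading[OF W _ g(1)]) (auto simp: h_def split: if_splits)
      then have "\<alpha> \<notin> Poly_Mapping.keys r"
        by (simp add: r_def in_keys_iff lookup_minus)
      have small: "W \<gamma> < W \<alpha>" if "\<gamma> \<in> Poly_Mapping.keys r" for \<gamma>
      proof -
        have "\<gamma> \<noteq> \<alpha>"
          using that \<open>\<alpha> \<notin> Poly_Mapping.keys r\<close> by blast
        then have "\<gamma> \<in> Poly_Mapping.keys (h * g)"
          using that by (auto simp: r_def in_keys_iff lookup_minus lookup_single)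
        then obtain b where "\<gamma> = \<beta> + b" "b \<in> Poly_Mapping.keys g"
          using keys_mult[of h g] by (auto simp: h_def split: if_splits)
        then show ?thesis
          using \<open>\<gamma> \<noteq> \<alpha>\<close> g(1) by (auto simp: \<alpha> W leading_def)
      qed
      have "(\<Sum>\<gamma>\<in>Poly_Mapping.keys r. Poly_Mapping.single \<gamma> (Poly_Mapping.lookup r \<gamma>)) \<in> D"
      proof (rule sum)
        fix \<gamma> assume \<gamma>: "\<gamma> \<in> Poly_Mapping.keys r"
        show "Poly_Mapping.single \<gamma> (Poly_Mapping.lookup r \<gamma>) \<in> D"
          using small[OF \<gamma>] pos[of \<gamma>] r \<gamma>
          by (intro less.hyps) (auto simp: carrier_mpol_ring)
      qed
      then have "r \<in> D"
        using mpol_eq_sum_single[of "Poly_Mapping.keys r" r] by simp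
      \<comment> \<open>The multiple h * g lies in D with remainder 0, and r by induction; their sum
        is the given monomial.\<close>
      then have "h * g + 0 + r \<in> D"
        using h by (intro add DI) auto
      then show ?thesis
        by (simp add: r_def)
    qed
  qed
  have "(\<Sum>\<gamma>\<in>Poly_Mapping.keys f. Poly_Mapping.single \<gamma> (Poly_Mapping.lookup f \<gamma>)) \<in> D"
    using f by (intro sum single) (auto simp: carrier_mpol_ring)
  then have "f \<in> D"
    using mpol_eq_sum_single[of "Poly_Mapping.keys f" f] by simp
  then show ?thesis
    by (simp add: D_def)
qed

section \<open>Flatness of modules with a dual basis\<close>

locale tensor_product = M: module R M + A: module R A
  for R :: "('r, 'x) ring_scheme" and M :: "('r, 'm) module" and A :: "('r, 'a) module"
begin

abbreviation \<K> where "\<K> \<equiv> tensor_kernel R M A"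
abbreviation \<F> where "\<F> \<equiv> free_Abelian_group (carrier M \<times> carrier A)"

lemma tensor_relations_subset: "tensor_relations R M A \<subseteq> carrier \<F>"
proof -
  have *: "frag_of a - frag_of b - frag_of c \<in> carrier \<F>"
    if "a \<in> carrier M \<times> carrier A" "b \<in> carrier M \<times> carrier A" "c \<in> carrier M \<times> carrier A" for a b c
    using that keys_diff[of "frag_of a - frag_of b" "frag_of c"] keys_diff[of "frag_of a" "frag_of b"]
    by auto
  have **: "frag_of a - frag_of b \<in> carrier \<F>"
    if "a \<in> carrier M \<times> carrier A" "b \<in> carrier M \<times> carrier A" for a b
    using that keys_diff[of "frag_of a" "frag_of b"] by auto
  show ?thesis
    unfolding tensor_relations_def by (safe; (rule * | rule **); simp)
qed

lemma subgroup_kernel: "subgroup \<K> \<F>"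
  unfolding tensor_kernel_def
  by (intro group.generate_is_subgroup tensor_relations_subset) simp

lemma kernel_keys: "u \<in> \<K> \<Longrightarrow> Poly_Mapping.keys u \<subseteq> carrier M \<times> carrier A"
  using subgroup.mem_carrier[OF subgroup_kernel, of u] by simp

lemma kernel_0: "0 \<in> \<K>"
  using subgroup.one_closed[OF subgroup_kernel] by simp

lemma kernel_add: "u \<in> \<K> \<Longrightarrow> v \<in> \<K> \<Longrightarrow> u + v \<in> \<K>"
  using subgroup.m_closed[OF subgroup_kernel] by simp

lemma kernel_uminus: "u \<in> \<K> \<Longrightarrow> - u \<in> \<K>"
  using subgroup.m_inv_closed[OF subgroup_kernel, of u] kernel_keys[of u] by simp

lemma kernel_diff: "u \<in> \<K> \<Longrightarrow> v \<in> \<K> \<Longrightarrow> u - v \<in> \<K>"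
  using kernel_add[of u "-v"] kernel_uminus[of v] by simp

lemma kernel_sum: "(\<And>i. i \<in> I \<Longrightarrow> u i \<in> \<K>) \<Longrightarrow> sum u I \<in> \<K>"
  by (induction I rule: infinite_finite_induct) (auto intro: kernel_0 kernel_add)

lemma kernel_add_left:
  "x \<in> carrier M \<Longrightarrow> y \<in> carrier M \<Longrightarrow> a \<in> carrier A \<Longrightarrow>
    frag_of (x \<oplus>\<^bsub>M\<^esub> y, a) - frag_of (x, a) - frag_of (y, a) \<in> \<K>"
  unfolding tensor_kernel_def tensor_relations_def by (rule generate.incl) blast

lemma kernel_add_right:
  "x \<in> carrier M \<Longrightarrow> a \<in> carrier A \<Longrightarrow> b \<in> carrier A \<Longrightarrow>
    frag_of (x, a \<oplus>\<^bsub>A\<^esub> b) - frag_of (x, a) - frag_of (x, b) \<in> \<K>"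
  unfolding tensor_kernel_def tensor_relations_def by (rule generate.incl) blast

lemma kernel_smult:
  "r \<in> carrier R \<Longrightarrow> x \<in> carrier M \<Longrightarrow> a \<in> carrier A \<Longrightarrow>
    frag_of (r \<odot>\<^bsub>M\<^esub> x, a) - frag_of (x, r \<odot>\<^bsub>A\<^esub> a) \<in> \<K>"
  unfolding tensor_kernel_def tensor_relations_def by (rule generate.incl) blast

text \<open>The additivity relation for zero plus zero collapses to the negative of this
  generator.\<close>

lemma kernel_zero_right: "x \<in> carrier M \<Longrightarrow> frag_of (x, \<zero>\<^bsub>A\<^esub>) \<in> \<K>"
  using kernel_uminus[OF kernel_add_right[of x "\<zero>\<^bsub>A\<^esub>" "\<zero>\<^bsub>A\<^esub>"]] by simp

lemma kernel_zero_left: "a \<in> carrier A \<Longrightarrow> frag_of (\<zero>\<^bsub>M\<^esub>, a) \<in> \<K>"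
  using kernel_uminus[OF kernel_add_left[of "\<zero>\<^bsub>M\<^esub>" "\<zero>\<^bsub>M\<^esub>" a]] by simp

text \<open>Iterated additivity on the left; it distributes a basis expansion of an element of M
  over the tensor sign.\<close>

lemma kernel_finsum_left:
  assumes "finite T" "a \<in> carrier A" "f \<in> T \<rightarrow> carrier M"
  shows "frag_of (finsum M f T, a) - (\<Sum>b\<in>T. frag_of (f b, a)) \<in> \<K>"
  using assms(1,3)
proof (induction T rule: finite_induct)
  case empty
  then show ?case using assms(2) by (simp add: kernel_zero_left)
next
  case (insert b T)
  then have "frag_of (f b \<oplus>\<^bsub>M\<^esub> finsum M f T, a) - frag_of (f b, a) - frag_of (finsum M f T, a) \<in> \<K>"
    using assms(2) by (intro kernel_add_left M.finsum_closed) auto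
  moreover have "frag_of (finsum M f T, a) - (\<Sum>b\<in>T. frag_of (f b, a)) \<in> \<K>"
    using insert by auto
  ultimately have "frag_of (f b \<oplus>\<^bsub>M\<^esub> finsum M f T, a) - frag_of (f b, a) - frag_of (finsum M f T, a)
      + (frag_of (finsum M f T, a) - (\<Sum>b\<in>T. frag_of (f b, a))) \<in> \<K>"
    by (rule kernel_add)
  moreover have "finsum M f (insert b T) = f b \<oplus>\<^bsub>M\<^esub> finsum M f T"
    using insert by (intro M.finsum_insert) auto
  ultimately show ?case
    using insert by (simp add: algebra_simps)
qed

text \<open>This is the map from M \<otimes> A to A induced by a linear form k on M, that is, k
  \<otimes> id followed by R \<otimes> A = A. It is written on representatives, and constrained only
  on formal sums supported in the carriers.\<close>

definition contraction :: "('m \<Rightarrow> 'r) \<Rightarrow> (('m \<times> 'a \<Rightarrow>\<^sub>0 int) \<Rightarrow> 'a) \<Rightarrow> bool" where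
  "contraction k \<phi> \<longleftrightarrow>
    (\<forall>u v. Poly_Mapping.keys u \<subseteq> carrier M \<times> carrier A \<longrightarrow> Poly_Mapping.keys v \<subseteq> carrier M \<times> carrier A \<longrightarrow>
      \<phi> (u + v) = \<phi> u \<oplus>\<^bsub>A\<^esub> \<phi> v) \<and>
    (\<forall>u. Poly_Mapping.keys u \<subseteq> carrier M \<times> carrier A \<longrightarrow> \<phi> u \<in> carrier A) \<and>
    (\<forall>x\<in>carrier M. \<forall>a\<in>carrier A. \<phi> (frag_of (x, a)) = k x \<odot>\<^bsub>A\<^esub> a) \<and>
    (\<forall>u\<in>\<K>. \<phi> u = \<zero>\<^bsub>A\<^esub>)"

text \<open>The universal property of the free abelian group extends (x, a) \<mapsto> k(x) a
  additively. The extension kills the relations because this pairing is additive in both arguments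
  and balanced over R.\<close>

lemma contraction_exists:
  assumes k: "k \<in> carrier M \<rightarrow> carrier R"
    and k_add: "\<And>x y. x \<in> carrier M \<Longrightarrow> y \<in> carrier M \<Longrightarrow> k (x \<oplus>\<^bsub>M\<^esub> y) = k x \<oplus>\<^bsub>R\<^esub> k y"
    and k_smult: "\<And>r x. r \<in> carrier R \<Longrightarrow> x \<in> carrier M \<Longrightarrow> k (r \<odot>\<^bsub>M\<^esub> x) = r \<otimes>\<^bsub>R\<^esub> k x"
  shows "\<exists>\<phi>. contraction k \<phi>"
proof -
  have "(\<lambda>(x, a). k x \<odot>\<^bsub>A\<^esub> a) ` (carrier M \<times> carrier A) \<subseteq> carrier (add_monoid A)"
    using k by auto
  from comm_group.free_Abelian_group_universal[OF A.a_comm_group this]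
  obtain \<phi> where \<phi>: "\<phi> \<in> hom \<F> (add_monoid A)"
    and gen: "\<And>x. x \<in> carrier M \<times> carrier A \<Longrightarrow> \<phi> (frag_of x) = (case x of (x, a) \<Rightarrow> k x \<odot>\<^bsub>A\<^esub> a)"
    by metis
  interpret \<phi>: group_hom \<F> "add_monoid A" \<phi>
    using \<phi> A.a_group by (simp add: group_hom_def group_hom_axioms_def)
  have add: "\<phi> (u + v) = \<phi> u \<oplus>\<^bsub>A\<^esub> \<phi> v" if "u \<in> carrier \<F>" "v \<in> carrier \<F>" for u v
    using \<phi>.hom_mult[OF that] by simp
  have closed: "\<phi> u \<in> carrier A" if "u \<in> carrier \<F>" for u
    using \<phi>.hom_closed[OF that] by simp
  have genp: "\<phi> (frag_of (x, a)) = k x \<odot>\<^bsub>A\<^esub> a" if "x \<in> carrier M" "a \<in> carrier A" for x a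
    using gen[of "(x, a)"] that by simp
  have diff: "\<phi> (u - v) = \<phi> u \<ominus>\<^bsub>A\<^esub> \<phi> v" if u: "u \<in> carrier \<F>" and v: "v \<in> carrier \<F>" for u v
  proof -
    have uv: "u - v \<in> carrier \<F>"
      using u v keys_diff[of u v] by auto
    then have "\<phi> u = \<phi> (u - v) \<oplus>\<^bsub>A\<^esub> \<phi> v"
      using add[OF uv v] by simp
    then show ?thesis
      using closed[OF uv] closed[OF v] closed[OF u]
      by (metis A.add.inv_solve_right' A.minus_eq)
  qed
  have frag: "frag_of (x, a) \<in> carrier \<F>" if "x \<in> carrier M" "a \<in> carrier A" for x a
    using that by simp
  have fragd: "frag_of (x, a) - frag_of (y, b) \<in> carrier \<F>"
    if "x \<in> carrier M" "a \<in> carrier A" "y \<in> carrier M" "b \<in> carrier A" for x y a b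
    using that keys_diff[of "frag_of (x, a)" "frag_of (y, b)"] by auto
  have zero: "(p \<oplus>\<^bsub>A\<^esub> q) \<ominus>\<^bsub>A\<^esub> p \<ominus>\<^bsub>A\<^esub> q = \<zero>\<^bsub>A\<^esub>" if "p \<in> carrier A" "q \<in> carrier A" for p q
    using A.r_neg[of "p \<oplus>\<^bsub>A\<^esub> q"] that by (simp add: A.minus_eq A.minus_add A.a_assoc)
  have kc: "k x \<in> carrier R" if "x \<in> carrier M" for x
    using k that by auto
  have "tensor_relations R M A \<subseteq> kernel \<F> (add_monoid A) \<phi>"
  proof
    fix u assume u: "u \<in> tensor_relations R M A"
    then have "\<phi> u = \<zero>\<^bsub>A\<^esub>"
      unfolding tensor_relations_def
    proof (elim UnE CollectE exE conjE)
      fix x y a assume "u = frag_of (x \<oplus>\<^bsub>M\<^esub> y, a) - frag_of (x, a) - frag_of (y, a)"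
        "x \<in> carrier M" "y \<in> carrier M" "a \<in> carrier A"
      then show ?thesis
        by (simp only: diff frag fragd M.a_closed genp k_add A.smult_l_distr kc zero A.smult_closed)
    next
      fix x a b assume "u = frag_of (x, a \<oplus>\<^bsub>A\<^esub> b) - frag_of (x, a) - frag_of (x, b)"
        "x \<in> carrier M" "a \<in> carrier A" "b \<in> carrier A"
      then show ?thesis
        by (simp only: diff frag fragd A.a_closed genp A.smult_r_distr kc zero A.smult_closed)
    next
      fix r x a assume "u = frag_of (r \<odot>\<^bsub>M\<^esub> x, a) - frag_of (x, r \<odot>\<^bsub>A\<^esub> a)"
        "r \<in> carrier R" "x \<in> carrier M" "a \<in> carrier A"
      \<comment> \<open>Commutativity of R enters here: k(r x) a = r k(x) a = k(x) (r a).\<close>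
      then show ?thesis
        by (simp add: diff genp k_smult kc A.smult_assoc1 M.m_comm[of r] A.minus_eq A.r_neg)
    qed
    then show "u \<in> kernel \<F> (add_monoid A) \<phi>"
      using subsetD[OF tensor_relations_subset u] by (simp add: kernel_def)
  qed
  then have "\<K> \<subseteq> kernel \<F> (add_monoid A) \<phi>"
    unfolding tensor_kernel_def
    by (rule group.generate_subgroup_incl[OF group_free_Abelian_group _ \<phi>.subgroup_kernel])
  then show ?thesis
    using add closed genp by (intro exI[of _ \<phi>]) (auto simp: contraction_def kernel_def)
qed

end

text \<open>The pattern is that of the dual basis of a projective module, with vectors
  \<open>e b\<close> and coordinate forms \<open>c b\<close>. Asking for the expansion over every
  finite T' above T says that further terms contribute nothing, and lets several expansions be
  compared over a common index set.\<close>

locale dual_basis = module R M for R :: "('r, 'x) ring_scheme" and M :: "('r, 'm) module" +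
  fixes B :: "'i set" and e :: "'i \<Rightarrow> 'm" and c :: "'i \<Rightarrow> 'm \<Rightarrow> 'r"
  assumes e_closed: "b \<in> B \<Longrightarrow> e b \<in> carrier M"
    and c_closed: "b \<in> B \<Longrightarrow> c b \<in> carrier M \<rightarrow> carrier R"
    and c_add: "b \<in> B \<Longrightarrow> x \<in> carrier M \<Longrightarrow> y \<in> carrier M \<Longrightarrow> c b (x \<oplus>\<^bsub>M\<^esub> y) = c b x \<oplus>\<^bsub>R\<^esub> c b y"
    and c_smult: "b \<in> B \<Longrightarrow> r \<in> carrier R \<Longrightarrow> x \<in> carrier M \<Longrightarrow> c b (r \<odot>\<^bsub>M\<^esub> x) = r \<otimes>\<^bsub>R\<^esub> c b x"
    and expansion: "x \<in> carrier M \<Longrightarrow> \<exists>T. finite T \<and> T \<subseteq> B \<and>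
      (\<forall>T'. finite T' \<longrightarrow> T \<subseteq> T' \<longrightarrow> T' \<subseteq> B \<longrightarrow> x = finsum M (\<lambda>b. c b x \<odot>\<^bsub>M\<^esub> e b) T')"

context dual_basis
begin

text \<open>For a generator, expand x and move the coordinates across the tensor sign: the sum of
  c_b(x) e_b \<otimes> a equals the sum of e_b \<otimes> c_b(x) a. Both sides are additive in u.
  Consequently a tensor vanishes as soon as all its contractions do.\<close>

lemma tensor_expansion:
  fixes A :: "('r, 'a) module"
  assumes "module R A"
    and \<phi>: "\<And>b. b \<in> B \<Longrightarrow> tensor_product.contraction R M A (c b) (\<phi> b)"
    and u: "Poly_Mapping.keys u \<subseteq> carrier M \<times> carrier A"
  shows "\<exists>T. finite T \<and> T \<subseteq> B \<and> (\<forall>T'. finite T' \<longrightarrow> T \<subseteq> T' \<longrightarrow> T' \<subseteq> B \<longrightarrow>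
    u - (\<Sum>b\<in>T'. frag_of (e b, \<phi> b u)) \<in> tensor_kernel R M A)"
proof -
  interpret tensor_product R M A
    using assms(1) module_axioms by (simp add: tensor_product_def)
  have add: "\<phi> b (u + v) = \<phi> b u \<oplus>\<^bsub>A\<^esub> \<phi> b v"
    if "b \<in> B" "Poly_Mapping.keys u \<subseteq> carrier M \<times> carrier A" "Poly_Mapping.keys v \<subseteq> carrier M \<times> carrier A" for b u v
    using \<phi>[OF that(1)] that(2,3) by (simp add: contraction_def)
  have closed: "\<phi> b u \<in> carrier A" if "b \<in> B" "Poly_Mapping.keys u \<subseteq> carrier M \<times> carrier A" for b u
    using \<phi>[OF that(1)] that(2) by (simp add: contraction_def)
  have gen: "\<phi> b (frag_of (x, a)) = c b x \<odot>\<^bsub>A\<^esub> a" if "b \<in> B" "x \<in> carrier M" "a \<in> carrier A" for b x a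
    using \<phi>[OF that(1)] that(2,3) by (simp add: contraction_def)
  show ?thesis
    using u
  proof (induction u rule: free_Abelian_group_induct[consumes 1, case_names zero diff frag_of])
    case zero
    have "\<phi> b 0 = \<zero>\<^bsub>A\<^esub>" if "b \<in> B" for b
      using add[of b 0 0] closed[of b 0] that by (simp add: A.add.l_cancel_one')
    then have "(\<Sum>b\<in>T'. frag_of (e b, \<phi> b 0)) \<in> \<K>" if "T' \<subseteq> B" for T'
      using that by (intro kernel_sum) (metis e_closed kernel_zero_right subsetD)
    then show ?case
      by (intro exI[of _ "{}"]) (auto dest!: kernel_uminus)
  next
    case (diff x y)
    obtain S where S: "finite S" "S \<subseteq> B"
        "\<And>T'. finite T' \<Longrightarrow> S \<subseteq> T' \<Longrightarrow> T' \<subseteq> B \<Longrightarrow> x - (\<Sum>b\<in>T'. frag_of (e b, \<phi> b x)) \<in> \<K>"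
      using diff.IH(1) by (elim exE conjE) simp
    obtain T where T: "finite T" "T \<subseteq> B"
        "\<And>T'. finite T' \<Longrightarrow> T \<subseteq> T' \<Longrightarrow> T' \<subseteq> B \<Longrightarrow> y - (\<Sum>b\<in>T'. frag_of (e b, \<phi> b y)) \<in> \<K>"
      using diff.IH(2) by (elim exE conjE) simp
    have xy: "Poly_Mapping.keys (x - y) \<subseteq> carrier M \<times> carrier A"
      using diff.hyps keys_diff[of x y] by auto
    have "(x - y) - (\<Sum>b\<in>T'. frag_of (e b, \<phi> b (x - y))) \<in> \<K>"
      if T': "finite T'" "S \<union> T \<subseteq> T'" "T' \<subseteq> B" for T'
    proof -
      have "frag_of (e b, \<phi> b x) - frag_of (e b, \<phi> b (x - y)) - frag_of (e b, \<phi> b y) \<in> \<K>" if "b \<in> T'" for b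
      proof -
        have "b \<in> B"
          using that T' by auto
        \<comment> \<open>A contraction is only known to respect sums, so the difference enters
          through x = (x - y) + y.\<close>
        then have "\<phi> b x = \<phi> b (x - y) \<oplus>\<^bsub>A\<^esub> \<phi> b y"
          using add[of b "x - y" y] xy diff by simp
        then show ?thesis
          using kernel_add_right[of "e b" "\<phi> b (x - y)" "\<phi> b y"] closed e_closed xy diff \<open>b \<in> B\<close> by simp
      qed
      then have "(\<Sum>b\<in>T'. frag_of (e b, \<phi> b x) - frag_of (e b, \<phi> b (x - y)) - frag_of (e b, \<phi> b y)) \<in> \<K>"
        by (rule kernel_sum)
      moreover have "(x - (\<Sum>b\<in>T'. frag_of (e b, \<phi> b x))) - (y - (\<Sum>b\<in>T'. frag_of (e b, \<phi> b y))) \<in> \<K>"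
        using T' by (intro kernel_diff S T) auto
      ultimately have "(x - (\<Sum>b\<in>T'. frag_of (e b, \<phi> b x))) - (y - (\<Sum>b\<in>T'. frag_of (e b, \<phi> b y)))
        + (\<Sum>b\<in>T'. frag_of (e b, \<phi> b x) - frag_of (e b, \<phi> b (x - y)) - frag_of (e b, \<phi> b y)) \<in> \<K>"
        by (rule kernel_add[rotated])
      then show ?thesis
        by (simp add: sum_subtractf sum.distrib algebra_simps)
    qed
    then show ?case
      using S T by (intro exI[of _ "S \<union> T"]) auto
  next
    case (frag_of p)
    then obtain x a where p: "p = (x, a)" "x \<in> carrier M" "a \<in> carrier A"
      by auto
    obtain T where T: "finite T" "T \<subseteq> B"
      "\<And>T'. finite T' \<Longrightarrow> T \<subseteq> T' \<Longrightarrow> T' \<subseteq> B \<Longrightarrow> x = finsum M (\<lambda>b. c b x \<odot>\<^bsub>M\<^esub> e b) T'"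
      using expansion[OF p(2)] by blast
    have "frag_of p - (\<Sum>b\<in>T'. frag_of (e b, \<phi> b (frag_of p))) \<in> \<K>"
      if T': "finite T'" "T \<subseteq> T'" "T' \<subseteq> B" for T'
    proof -
      have c: "c b x \<in> carrier R" if "b \<in> T'" for b
        using c_closed[of b] that T' p by auto
      have "(\<lambda>b. c b x \<odot>\<^bsub>M\<^esub> e b) \<in> T' \<rightarrow> carrier M"
        using c e_closed T'(3) by auto
      from kernel_finsum_left[OF T'(1) p(3) this]
      have "frag_of (x, a) - (\<Sum>b\<in>T'. frag_of (c b x \<odot>\<^bsub>M\<^esub> e b, a)) \<in> \<K>"
        by (simp only: T(3)[OF T', symmetric])
      \<comment> \<open>The scalars c_b(x) cross the tensor sign, one relation for each b.\<close>
      moreover have "(\<Sum>b\<in>T'. frag_of (c b x \<odot>\<^bsub>M\<^esub> e b, a) - frag_of (e b, c b x \<odot>\<^bsub>A\<^esub> a)) \<in> \<K>"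
        using T' c e_closed p by (intro kernel_sum kernel_smult) auto
      ultimately have "frag_of (x, a) - (\<Sum>b\<in>T'. frag_of (c b x \<odot>\<^bsub>M\<^esub> e b, a))
        + (\<Sum>b\<in>T'. frag_of (c b x \<odot>\<^bsub>M\<^esub> e b, a) - frag_of (e b, c b x \<odot>\<^bsub>A\<^esub> a)) \<in> \<K>"
        by (rule kernel_add)
      moreover have "(\<Sum>b\<in>T'. frag_of (e b, \<phi> b (frag_of p))) = (\<Sum>b\<in>T'. frag_of (e b, c b x \<odot>\<^bsub>A\<^esub> a))"
        using T' p gen by (intro sum.cong refl) auto
      ultimately show ?thesis
        by (simp add: sum_subtractf p)
    qed
    then show ?case
      using T by (intro exI[of _ T]) auto
  qed
qed

text \<open>
  The coordinates give contractions \<open>M \<otimes> A \<rightarrow> A\<close>, which are natural in \<open>A\<close> and jointly injective.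
\<close>

lemma flat: "flat_module TYPE('a) TYPE('b) R M"
  unfolding flat_module_def
proof (intro conjI allI impI)
  show "module R M" by (rule module_axioms)
next
  fix A :: "('r, 'a) module" and A' :: "('r, 'b) module" and f :: "'a \<Rightarrow> 'b"
  assume *: "module R A \<and> module R A' \<and> f \<in> linear_maps R A A' \<and> inj_on f (carrier A)"
  interpret A: tensor_product R M A
    using * module_axioms by (simp add: tensor_product_def)
  interpret A': tensor_product R M A'
    using * module_axioms by (simp add: tensor_product_def)
  have f_closed: "f a \<in> carrier A'" if "a \<in> carrier A" for a
    using that * by (auto simp: linear_maps_def)
  have f_add: "f (a \<oplus>\<^bsub>A\<^esub> b) = f a \<oplus>\<^bsub>A'\<^esub> f b" if "a \<in> carrier A" "b \<in> carrier A" for a b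
    using that * by (auto simp: linear_maps_def)
  have f_smult: "f (r \<odot>\<^bsub>A\<^esub> b) = r \<odot>\<^bsub>A'\<^esub> f b" if "r \<in> carrier R" "b \<in> carrier A" for r b
    using that * by (auto simp: linear_maps_def)
  have f_zero: "f \<zero>\<^bsub>A\<^esub> = \<zero>\<^bsub>A'\<^esub>"
    using f_add[of "\<zero>\<^bsub>A\<^esub>" "\<zero>\<^bsub>A\<^esub>"] f_closed[of "\<zero>\<^bsub>A\<^esub>"] by (simp add: A'.A.add.l_cancel_one')
  have f_inj: "a = \<zero>\<^bsub>A\<^esub>" if "a \<in> carrier A" "f a = \<zero>\<^bsub>A'\<^esub>" for a
    using * that f_zero by (metis A.A.zero_closed inj_onD)
  have "\<forall>b\<in>B. \<exists>\<phi>. A.contraction (c b) \<phi>"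
    using c_closed c_add c_smult by (intro ballI A.contraction_exists) auto
  from bchoice[OF this] obtain \<phi> where \<phi>: "\<And>b. b \<in> B \<Longrightarrow> A.contraction (c b) (\<phi> b)"
    by blast
  have \<phi>_add: "\<phi> b (u + v) = \<phi> b u \<oplus>\<^bsub>A\<^esub> \<phi> b v"
    if "b \<in> B" "Poly_Mapping.keys u \<subseteq> carrier M \<times> carrier A" "Poly_Mapping.keys v \<subseteq> carrier M \<times> carrier A" for b u v
    using \<phi>[OF that(1)] that(2,3) by (simp add: A.contraction_def)
  have \<phi>_closed: "\<phi> b u \<in> carrier A" if "b \<in> B" "Poly_Mapping.keys u \<subseteq> carrier M \<times> carrier A" for b u
    using \<phi>[OF that(1)] that(2) by (simp add: A.contraction_def)
  have \<phi>_gen: "\<phi> b (frag_of (x, a)) = c b x \<odot>\<^bsub>A\<^esub> a" if "b \<in> B" "x \<in> carrier M" "a \<in> carrier A" for b x a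
    using \<phi>[OF that(1)] that(2,3) by (simp add: A.contraction_def)
  have "\<forall>b\<in>B. \<exists>\<phi>. A'.contraction (c b) \<phi>"
    using c_closed c_add c_smult by (intro ballI A'.contraction_exists) auto
  from bchoice[OF this] obtain \<psi> where \<psi>: "\<And>b. b \<in> B \<Longrightarrow> A'.contraction (c b) (\<psi> b)"
    by blast
  have \<psi>_add: "\<psi> b (u + v) = \<psi> b u \<oplus>\<^bsub>A'\<^esub> \<psi> b v"
    if "b \<in> B" "Poly_Mapping.keys u \<subseteq> carrier M \<times> carrier A'" "Poly_Mapping.keys v \<subseteq> carrier M \<times> carrier A'" for b u v
    using \<psi>[OF that(1)] that(2,3) by (simp add: A'.contraction_def)
  have \<psi>_closed: "\<psi> b u \<in> carrier A'" if "b \<in> B" "Poly_Mapping.keys u \<subseteq> carrier M \<times> carrier A'" for b u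
    using \<psi>[OF that(1)] that(2) by (simp add: A'.contraction_def)
  have \<psi>_gen: "\<psi> b (frag_of (x, a)) = c b x \<odot>\<^bsub>A'\<^esub> a" if "b \<in> B" "x \<in> carrier M" "a \<in> carrier A'" for b x a
    using \<psi>[OF that(1)] that(2,3) by (simp add: A'.contraction_def)
  have \<psi>_kernel: "\<psi> b u = \<zero>\<^bsub>A'\<^esub>" if "b \<in> B" "u \<in> A'.\<K>" for b u
    using \<psi>[OF that(1)] that(2) by (simp add: A'.contraction_def)
  \<comment> \<open>The map underlying \<open>tensor_map\<close> on formal sums, before passing to
    cosets.\<close>
  define g where "g = (frag_extend (\<lambda>(x, a). frag_of (x, f a)) :: ('m \<times> 'a \<Rightarrow>\<^sub>0 int) \<Rightarrow> _)"
  have g_keys: "Poly_Mapping.keys (g w) \<subseteq> carrier M \<times> carrier A'"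
    if "Poly_Mapping.keys w \<subseteq> carrier M \<times> carrier A" for w
  proof -
    have "(\<Union>p\<in>Poly_Mapping.keys w. Poly_Mapping.keys ((\<lambda>(x, a). frag_of (x, f a)) p)) \<subseteq> carrier M \<times> carrier A'"
      using that f_closed by (intro UN_least) (auto split: prod.splits)
    then show ?thesis
      unfolding g_def using keys_frag_extend by (rule subset_trans[rotated])
  qed
  have natural: "\<psi> b (g w) = f (\<phi> b w)"
    if "b \<in> B" "Poly_Mapping.keys w \<subseteq> carrier M \<times> carrier A" for b w
    using that(2)
  proof (induction w rule: free_Abelian_group_induct[consumes 1, case_names zero diff frag_of])
    case zero
    have "\<phi> b 0 = \<zero>\<^bsub>A\<^esub>"
      using \<phi>_add[of b 0 0] \<phi>_closed[of b 0] that(1) by (simp add: A.A.add.l_cancel_one')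
    moreover have "\<psi> b 0 = \<zero>\<^bsub>A'\<^esub>"
      using \<psi>_kernel[of b 0] A'.kernel_0 that(1) by simp
    ultimately show ?case
      by (simp add: g_def f_zero)
  next
    case (diff x y)
    have xy: "Poly_Mapping.keys (x - y) \<subseteq> carrier M \<times> carrier A"
      using diff.hyps keys_diff[of x y] by auto
    have "\<psi> b (g (x - y)) \<oplus>\<^bsub>A'\<^esub> \<psi> b (g y) = \<psi> b (g x)"
      using \<psi>_add[OF that(1) g_keys[OF xy] g_keys[OF diff.hyps(2)]] by (simp add: g_def frag_extend_diff)
    also have "\<dots> = f (\<phi> b (x - y) \<oplus>\<^bsub>A\<^esub> \<phi> b y)"
      using diff \<phi>_add[OF that(1) xy diff.hyps(2)] by simp
    also have "\<dots> = f (\<phi> b (x - y)) \<oplus>\<^bsub>A'\<^esub> \<psi> b (g y)"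
      using diff xy that \<phi>_closed f_add by simp
    finally show ?case
      using \<psi>_closed g_keys f_closed \<phi>_closed that(1) xy diff by (simp add: A'.A.add.right_cancel)
  next
    case (frag_of p)
    then show ?case
      using that(1) c_closed by (auto simp: g_def \<phi>_gen \<psi>_gen f_closed f_smult Pi_iff)
  qed
  \<comment> \<open>Injectivity on representatives: contractions of g w vanish, naturality and
    injectivity of f make those of w vanish, and the expansion then puts w among the
    relations.\<close>
  have reflect: "w \<in> A.\<K>" if w: "Poly_Mapping.keys w \<subseteq> carrier M \<times> carrier A" "g w \<in> A'.\<K>" for w
  proof -
    have zero: "\<phi> b w = \<zero>\<^bsub>A\<^esub>" if "b \<in> B" for b
      using \<psi>_kernel[OF that w(2)] natural[OF that w(1)] by (intro f_inj \<phi>_closed that w) simp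
    obtain T where T: "finite T" "T \<subseteq> B" "w - (\<Sum>b\<in>T. frag_of (e b, \<phi> b w)) \<in> A.\<K>"
      using tensor_expansion[OF A.A.module_axioms \<phi> w(1)] by blast
    have "(\<Sum>b\<in>T. frag_of (e b, \<phi> b w)) \<in> A.\<K>"
      using T(2) by (intro A.kernel_sum) (metis A.kernel_zero_right e_closed subsetD zero)
    from A.kernel_add[OF T(3) this] show ?thesis
      by simp
  qed
  show "inj_on (tensor_map R M A' f) (carrier (tensor R M A))"
  proof (rule inj_onI)
    fix C1 C2
    assume C: "C1 \<in> carrier (tensor R M A)" "C2 \<in> carrier (tensor R M A)"
      and eq: "tensor_map R M A' f C1 = tensor_map R M A' f C2"
    obtain u1 u2 where u: "u1 \<in> carrier A.\<F>" "C1 = A.\<K> #>\<^bsub>A.\<F>\<^esub> u1" "u2 \<in> carrier A.\<F>" "C2 = A.\<K> #>\<^bsub>A.\<F>\<^esub> u2"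
      using C unfolding tensor_def FactGroup_def RCOSETS_def by auto
    have "u1 \<in> C1"
      unfolding u r_coset_def using A.kernel_0 by force
    then have "g u1 \<in> tensor_map R M A' f C1"
      unfolding tensor_map_def set_mult_def g_def using A'.kernel_0 by force
    \<comment> \<open>Equal images only provide some u in C2 for which g u1 - g u is a relation.
      Then \<open>reflect\<close> applies to u1 - u, and u differs from u2 by one more
      relation.\<close>
    then obtain k u where k: "k \<in> A'.\<K>" "u \<in> C2" "g u1 = k + g u"
      unfolding eq unfolding tensor_map_def set_mult_def g_def by auto
    obtain l where l: "l \<in> A.\<K>" "u = l + u2"
      using k(2) unfolding u r_coset_def by auto
    have "Poly_Mapping.keys u \<subseteq> carrier M \<times> carrier A"
      using l u A.kernel_keys[of l] keys_add[of l u2] by auto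
    then have "u1 - u \<in> A.\<K>"
      using u k keys_diff[of u1 u] by (intro reflect) (auto simp: g_def frag_extend_diff)
    from A.kernel_add[OF this l(1)] have "u1 - u2 \<in> A.\<K>"
      using l by simp
    then have "u1 \<in> A.\<K> #>\<^bsub>A.\<F>\<^esub> u2"
      unfolding r_coset_def by (auto intro!: bexI[of _ "u1 - u2"])
    then show "C1 = C2"
      unfolding u by (intro group.repr_independence[symmetric] A.subgroup_kernel) (use u in auto)
  qed
qed

end

section \<open>Hypersurface rings with unit leading coefficient are flat\<close>

text \<open>The coordinates of a class are the coefficients of its normal form. The index set
  consists of all monomials in V; those divisible by the leading monomial simply have coordinate 0,
  which avoids restricting to standard monomials.\<close>

lemma flat_quotient_module:
  fixes g :: "'k::comm_ring_1 mpol"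
  assumes W: "\<And>\<alpha> \<beta>. W (\<alpha> + \<beta>) = W \<alpha> + W \<beta>" and pos: "\<And>\<alpha>. W \<alpha> \<ge> 0"
    and g: "leading W g m" "g \<in> carrier (mpol_ring V)"
  shows "flat_module TYPE('a) TYPE('b) (ring_of_type_algebra :: 'k ring)
    (quotient_module V (PIdl\<^bsub>mpol_ring V\<^esub> g))"
proof -
  let ?P = "mpol_ring V :: 'k mpol ring"
  define I where "I = PIdl\<^bsub>?P\<^esub> g"
  define Q where "Q = quotient_module V I"
  define cls where "cls f = I +>\<^bsub>?P\<^esub> f" for f
  let ?R = "ring_of_type_algebra :: 'k ring"
  interpret P: cring ?P
    by (rule cring_mpol_ring)
  interpret I: ideal I ?P
    unfolding I_def by (rule P.cgenideal_ideal[OF g(2)])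
  have I: "I = {h * g | h. h \<in> carrier ?P}"
    unfolding I_def cgenideal_def by simp
  have cls_mem: "x \<in> cls f \<longleftrightarrow> (\<exists>h\<in>carrier ?P. x = h * g + f)" for x f
  proof -
    have "x \<in> cls f \<longleftrightarrow> (\<exists>i\<in>I. x = i + f)"
      by (auto simp: cls_def a_r_coset_def')
    then show ?thesis
      unfolding I by blast
  qed
  have Q_carrier: "carrier Q = cls ` carrier ?P"
    by (auto simp: Q_def quotient_module_def Let_def FactRing_def A_RCOSETS_def' cls_def)
  have Q_add: "cls x \<oplus>\<^bsub>Q\<^esub> cls y = cls (x + y)" if "x \<in> carrier ?P" "y \<in> carrier ?P" for x y
    using I.a_rcos_sum[OF that]
    by (simp add: Q_def quotient_module_def Let_def FactRing_def cls_def)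
  have Q_zero: "\<zero>\<^bsub>Q\<^esub> = cls 0"
    using P.a_coset_add_zero[OF I.a_subset]
    by (simp add: Q_def quotient_module_def Let_def FactRing_def cls_def)
  have Q_smult: "c \<odot>\<^bsub>Q\<^esub> cls x = cls (const c * x)" if "x \<in> carrier ?P" for c x
    using I.rcoset_mult_add[of "const c" x] that
    by (simp add: Q_def quotient_module_def Let_def FactRing_def cls_def)
  have R [simp]: "carrier ?R = UNIV" "monoid.mult ?R = (*)" "one ?R = 1" "zero ?R = 0" "add ?R = (+)"
    by (simp_all add: ring_of_type_algebra_def)
  have const_simps: "const 1 = (1 :: 'k mpol)" "const (a + b) = const a + (const b :: 'k mpol)"
    "const (a * b) = const a * (const b :: 'k mpol)" for a b
    by (simp_all add: const_def single_add mult_single)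
  interpret Q: abelian_group Q
  proof (rule abelian_groupI)
    fix x assume "x \<in> carrier Q"
    then obtain f where f: "f \<in> carrier ?P" "x = cls f"
      by (auto simp: Q_carrier)
    then show "\<exists>y\<in>carrier Q. y \<oplus>\<^bsub>Q\<^esub> x = \<zero>\<^bsub>Q\<^esub>"
      by (intro bexI[of _ "cls (- f)"]) (auto simp: Q_carrier Q_add Q_zero)
  qed (auto simp: Q_carrier Q_add Q_zero algebra_simps)
  have Q: "module ?R Q"
    by (rule moduleI)
      (auto simp: Q_carrier Q_add Q_smult const_simps algebra_simps Q.abelian_group_axioms)

  \<comment> \<open>The description singles out one polynomial for each class: division yields a
    reduced representative, and two of them differ by a reduced multiple of g, hence by 0.\<close>
  define nf where "nf C = (THE r. r \<in> C \<and> reduced m r)" for C :: "'k mpol set"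
  have nf: "nf (cls f) = r"
    if "f = h * g + r" "h \<in> carrier ?P" "r \<in> carrier ?P" "reduced m r" for f h r
    unfolding nf_def
  proof (rule the_equality)
    have "r = (- h) * g + f"
      using that(1) by simp
    then show "r \<in> cls f \<and> reduced m r"
      unfolding cls_mem using that mpol_ring_closed(5) by blast
  next
    fix r' assume r': "r' \<in> cls f \<and> reduced m r'"
    then obtain h' where "r' = h' * g + f"
      by (auto simp: cls_mem)
    then have diff: "r' - r = (h' + h) * g"
      using that(1) by (simp add: algebra_simps)
    have "reduced m (r' - r)"
      using r' that by (intro reduced_diff) auto
    then have "r' - r = 0"
      unfolding diff by (rule reduced_multiple_eq_0[OF W g(1)])
    then show "r' = r"
      by simp
  qed
  have div: "\<exists>h\<in>carrier ?P. \<exists>r\<in>carrier ?P. reduced m r \<and> f = h * g + r" if "f \<in> carrier ?P" for f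
    using division_exists[OF W pos g] that by simp
  have nf_add: "nf (cls (x + y)) = nf (cls x) + nf (cls y)" if xy: "x \<in> carrier ?P" "y \<in> carrier ?P" for x y
  proof -
    obtain h r where h: "h \<in> carrier ?P" "r \<in> carrier ?P" "reduced m r" "x = h * g + r"
      using div[OF xy(1)] by blast
    obtain k s where k: "k \<in> carrier ?P" "s \<in> carrier ?P" "reduced m s" "y = k * g + s"
      using div[OF xy(2)] by blast
    have "nf (cls (x + y)) = r + s"
      using h k by (intro nf[of _ "h + k"]) (auto simp: algebra_simps reduced_add)
    then show ?thesis
      using nf[of x h r] nf[of y k s] h k by simp
  qed
  have nf_smult: "nf (cls (const c * x)) = const c * nf (cls x)" if x: "x \<in> carrier ?P" for c x
  proof -
    obtain h r where h: "h \<in> carrier ?P" "r \<in> carrier ?P" "reduced m r" "x = h * g + r"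
      using div[OF x] by blast
    have "nf (cls (const c * x)) = const c * r"
      using h by (intro nf[of _ "const c * h"]) (simp_all add: distrib_left mult.assoc reduced_const_mult)
    then show ?thesis
      using nf[of x h r] h by simp
  qed

  have "dual_basis ?R Q {\<alpha>. Poly_Mapping.keys \<alpha> \<subseteq> V} (\<lambda>\<alpha>. cls (Poly_Mapping.single \<alpha> 1))
    (\<lambda>\<alpha> C. Poly_Mapping.lookup (nf C) \<alpha>)"
  proof (intro dual_basis.intro Q dual_basis_axioms.intro)
    fix C assume "C \<in> carrier Q"
    then obtain f where f: "f \<in> carrier ?P" "C = cls f"
      by (auto simp: Q_carrier)
    obtain h r where h: "h \<in> carrier ?P" "r \<in> carrier ?P" "reduced m r" "f = h * g + r"
      using div[OF f(1)] by blast
    have r: "nf C = r"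
      using nf[of f h r] f h by simp
    \<comment> \<open>The class is represented by its own normal form, whose monomials then give the
      expansion.\<close>
    have "h * g + r \<in> I +>\<^bsub>?P\<^esub> r"
      using h(1) cls_mem[of "h * g + r" r] by (auto simp: cls_def)
    then have C: "C = cls r"
      using P.a_repr_independence[OF _ h(2) I.a_subgroup] h f
      by (simp add: cls_def)
    have sum: "finsum Q (\<lambda>\<alpha>. Poly_Mapping.lookup r \<alpha> \<odot>\<^bsub>Q\<^esub> cls (Poly_Mapping.single \<alpha> 1)) T =
        cls (\<Sum>\<alpha>\<in>T. Poly_Mapping.single \<alpha> (Poly_Mapping.lookup r \<alpha>))"
      if "finite T" "T \<subseteq> {\<alpha>. Poly_Mapping.keys \<alpha> \<subseteq> V}" for T
      using that
    proof (induction T rule: finite_induct)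
      case (insert \<alpha> T)
      then show ?case
        using mpol_ring_sum[of T "\<lambda>\<alpha>. Poly_Mapping.single \<alpha> (Poly_Mapping.lookup r \<alpha>)" V]
        by (subst Q.finsum_insert)
          (auto simp: Q_carrier Q_smult Q_add const_def mult_single subset_iff)
    qed (simp add: Q_zero)
    show "\<exists>T. finite T \<and> T \<subseteq> {\<alpha>. Poly_Mapping.keys \<alpha> \<subseteq> V} \<and> (\<forall>T'. finite T' \<longrightarrow> T \<subseteq> T' \<longrightarrow>
        T' \<subseteq> {\<alpha>. Poly_Mapping.keys \<alpha> \<subseteq> V} \<longrightarrow>
        C = finsum Q (\<lambda>\<alpha>. Poly_Mapping.lookup (nf C) \<alpha> \<odot>\<^bsub>Q\<^esub> cls (Poly_Mapping.single \<alpha> 1)) T')"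
    \<comment> \<open>Outside the support of r the coefficients are 0, so any larger finite index
      set gives the same sum.\<close>
    proof (intro exI[of _ "Poly_Mapping.keys r"] conjI allI impI)
      show "Poly_Mapping.keys r \<subseteq> {\<alpha>. Poly_Mapping.keys \<alpha> \<subseteq> V}"
        using h(2) by (auto simp: carrier_mpol_ring)
      fix T' assume "finite T'" "Poly_Mapping.keys r \<subseteq> T'" "T' \<subseteq> {\<alpha>. Poly_Mapping.keys \<alpha> \<subseteq> V}"
      then show "C = finsum Q (\<lambda>\<alpha>. Poly_Mapping.lookup (nf C) \<alpha> \<odot>\<^bsub>Q\<^esub> cls (Poly_Mapping.single \<alpha> 1)) T'"
        unfolding r by (simp only: sum C mpol_eq_sum_single[symmetric])
    qed simp
  qed (auto simp: Q_carrier Q_add Q_smult nf_add nf_smult lookup_add lookup_const_mult)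
  from dual_basis.flat[OF this] show ?thesis
    by (simp add: Q_def I_def)
qed

section \<open>Weights, specialization and dehomogenization\<close>

lemma weight_add: "weight w (\<alpha> + \<beta>) = weight w \<alpha> + weight w \<beta>"
  unfolding weight_def
  by (rule setsum_keys_plus_distrib[where f = "\<lambda>i k. w i * k"]) (simp_all add: distrib_left)

lemma weight_single [simp]: "weight w (Poly_Mapping.single i k) = w i * k"
  by (simp add: weight_def)

text \<open>The degree is treated as the weight with all variables of weight 1, and so inherits
  \<open>weight_add\<close>.\<close>

lemma homogeneous_iff_weight:
  "homogeneous d f \<longleftrightarrow> (\<forall>\<alpha>\<in>Poly_Mapping.keys f. weight (\<lambda>_. 1) \<alpha> = d)"
  by (simp add: homogeneous_def weight_def)

lemma homogeneous_add: "homogeneous d f \<Longrightarrow> homogeneous d g \<Longrightarrow> homogeneous d (f + g)"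
  using keys_add[of f g] unfolding homogeneous_iff_weight by blast

lemma homogeneous_sum: "(\<And>i. i \<in> I \<Longrightarrow> homogeneous d (f i)) \<Longrightarrow> homogeneous d (sum f I)"
  using keys_sum[of f I] unfolding homogeneous_iff_weight by blast

lemma homogeneous_mult:
  "homogeneous d f \<Longrightarrow> homogeneous e g \<Longrightarrow> homogeneous (d + e) (f * g :: 'k::comm_ring_1 mpol)"
  using keys_mult[of f g] unfolding homogeneous_iff_weight by (fastforce simp: weight_add)

lemma homogeneous_prod:
  fixes f :: "'i \<Rightarrow> 'k::comm_ring_1 mpol"
  assumes "\<And>i. i \<in> I \<Longrightarrow> homogeneous (d i) (f i)"
  shows "homogeneous (sum d I) (prod f I)"
proof -
  have "homogeneous 0 (1 :: 'k mpol)"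
    by (simp add: homogeneous_def)
  then show ?thesis
    using assms by (induction I rule: infinite_finite_induct) (auto intro!: homogeneous_mult)
qed

lemma homogeneous_single: "weight (\<lambda>_. 1) \<alpha> = d \<Longrightarrow> homogeneous d (Poly_Mapping.single \<alpha> c)"
  by (simp add: homogeneous_iff_weight)

section \<open>Specialization of the parameter t\<close>

lemma lookup_specialize: "Poly_Mapping.lookup (specialize c f) \<alpha> = poly (Poly_Mapping.lookup f \<alpha>) c"
  by (simp add: specialize_def map.rep_eq when_def)

lemma keys_specialize: "Poly_Mapping.keys (specialize c f) \<subseteq> Poly_Mapping.keys f"
  by (auto simp: in_keys_iff lookup_specialize)

lemma specialize_single [simp]: "specialize c (Poly_Mapping.single \<alpha> p) = Poly_Mapping.single \<alpha> (poly p c)"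
  by (rule poly_mapping_eqI) (simp add: lookup_specialize lookup_single when_def)

lemma specialize_add: "specialize c (f + g) = specialize c f + specialize c g"
  by (rule poly_mapping_eqI) (simp add: lookup_specialize lookup_add)

lemma specialize_sum: "specialize c (sum f I) = (\<Sum>i\<in>I. specialize c (f i))"
  by (rule poly_mapping_eqI) (simp add: lookup_specialize lookup_sum poly_sum)

lemma specialize_mult: "specialize c (f * g) = specialize c f * specialize c g"
proof (rule poly_mapping_eqI)
  fix \<gamma>
  show "Poly_Mapping.lookup (specialize c (f * g)) \<gamma> = Poly_Mapping.lookup (specialize c f * specialize c g) \<gamma>"
    unfolding lookup_specialize lookup_times[OF finite_keys order_refl finite_keys order_refl, of f g]
      lookup_times[OF finite_keys[of f] keys_specialize finite_keys[of g] keys_specialize]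
    by (simp add: poly_sum if_distrib[of "\<lambda>p. poly p c"] cong: if_cong)
qed

lemma specialize_1 [simp]: "specialize c 1 = 1"
  by (simp flip: single_one)

lemma specialize_prod: "specialize c (prod f I) = (\<Prod>i\<in>I. specialize c (f i))"
  by (induction I rule: infinite_finite_induct) (simp_all add: specialize_mult)

lemma specialize_carrier: "f \<in> carrier (mpol_ring V) \<Longrightarrow> specialize c f \<in> carrier (mpol_ring V)"
  using keys_specialize[of c f] by (auto simp: carrier_mpol_ring)

lemma specialize_image_carrier: "specialize c ` carrier (mpol_ring V) = carrier (mpol_ring V)"
proof (intro equalityI subsetI)
  fix f :: "complex mpol" assume f: "f \<in> carrier (mpol_ring V)"
  \<comment> \<open>Coefficients lift to constant polynomials, whose value at every c is the
    original one.\<close>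
  define g where "g = Poly_Mapping.map (\<lambda>a. [:a:]) f"
  have lookup: "Poly_Mapping.lookup g \<alpha> = [:Poly_Mapping.lookup f \<alpha>:]" for \<alpha>
    by (simp add: g_def map.rep_eq when_def)
  have "f = specialize c g"
    by (rule poly_mapping_eqI) (simp add: lookup_specialize lookup)
  moreover have "g \<in> carrier (mpol_ring V)"
    using f by (simp add: carrier_mpol_ring in_keys_iff lookup)
  ultimately show "f \<in> specialize c ` carrier (mpol_ring V)"
    by blast
qed (auto intro: specialize_carrier)

text \<open>Surjectivity of specialization is what makes the image a full principal ideal: every
  multiplier over the complex numbers comes from one over the polynomials in t.\<close>

lemma specialize_image_cgenideal:
  "specialize c ` (PIdl\<^bsub>mpol_ring V\<^esub> g) = PIdl\<^bsub>mpol_ring V\<^esub> (specialize c g)"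
proof -
  have "specialize c ` (PIdl\<^bsub>mpol_ring V\<^esub> g) = {specialize c h * specialize c g | h. h \<in> carrier (mpol_ring V)}"
    unfolding cgenideal_def mpol_ring_simps specialize_mult[symmetric] by blast
  also have "\<dots> = {h * specialize c g | h. h \<in> specialize c ` carrier (mpol_ring V)}"
    by blast
  finally show ?thesis
    by (simp add: specialize_image_carrier cgenideal_def)
qed

section \<open>Setting one coordinate equal to 1\<close>

lemma dehomogenize_superset:
  assumes "finite A" "Poly_Mapping.keys f \<subseteq> A"
  shows "dehomogenize i f =
    (\<Sum>\<alpha>\<in>A. Poly_Mapping.single (Poly_Mapping.update i 0 \<alpha>) (Poly_Mapping.lookup f \<alpha>))"
  unfolding dehomogenize_def using assms
  by (intro sum.mono_neutral_left) (auto simp: in_keys_iff)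

lemma specialize_dehomogenize: "specialize c (dehomogenize i f) = dehomogenize i (specialize c f)"
  unfolding dehomogenize_superset[OF finite_keys[of f] order_refl]
    dehomogenize_superset[OF finite_keys[of f] keys_specialize]
  by (simp add: specialize_sum lookup_specialize)

lemma fibre_hypersurface: "fibre N c (hypersurface N f) = hypersurface N (specialize c f)"
  unfolding fibre_def hypersurface_def
  by (rule restrict_ext) (simp add: specialize_image_cgenideal specialize_dehomogenize)

lemma keys_dehomogenize:
  "Poly_Mapping.keys (dehomogenize i f) \<subseteq> Poly_Mapping.update i 0 ` Poly_Mapping.keys f"
  unfolding dehomogenize_def
  using keys_sum[of "\<lambda>\<alpha>. Poly_Mapping.single (Poly_Mapping.update i 0 \<alpha>) (Poly_Mapping.lookup f \<alpha>)" "Poly_Mapping.keys f"]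
  by (auto split: if_splits)

lemma dehomogenize_carrier:
  "f \<in> carrier (mpol_ring {..N}) \<Longrightarrow> dehomogenize i f \<in> carrier (mpol_ring (chart_vars N i))"
  using keys_dehomogenize[of i f] by (fastforce simp: carrier_mpol_ring keys_update chart_vars_def)

lemma weight_update:
  assumes "w i = 0"
  shows "weight w (Poly_Mapping.update i 0 \<alpha>) = weight w \<alpha>"
proof -
  have "\<alpha> = Poly_Mapping.update i 0 \<alpha> + Poly_Mapping.single i (Poly_Mapping.lookup \<alpha> i)"
    by (rule poly_mapping_eqI) (auto simp: lookup_add lookup_update lookup_single)
  then have "weight w \<alpha> = weight w (Poly_Mapping.update i 0 \<alpha>) + w i * Poly_Mapping.lookup \<alpha> i"
    by (metis weight_add weight_single)
  then show ?thesis
    using assms by simp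
qed

text \<open>Setting p_i = 1 may merge monomials, but only those of equal W. As m alone has its value
  of W, nothing merges with it: its coefficient stays 1 and everything else stays strictly
  below.\<close>

lemma leading_dehomogenize:
  assumes W: "\<And>\<alpha>. W (Poly_Mapping.update i 0 \<alpha>) = W \<alpha>" and f: "leading W f m"
  shows "leading W (dehomogenize i f) (Poly_Mapping.update i 0 m)"
  unfolding leading_def
proof (intro conjI ballI impI)
  have eq: "Poly_Mapping.update i 0 \<alpha> = Poly_Mapping.update i 0 m \<longleftrightarrow> \<alpha> = m"
    if "\<alpha> \<in> Poly_Mapping.keys f" for \<alpha>
    using that f W[of \<alpha>] W[of m] unfolding leading_def by (metis less_irrefl)
  have "Poly_Mapping.lookup (dehomogenize i f) (Poly_Mapping.update i 0 m) =
      (\<Sum>\<alpha>\<in>Poly_Mapping.keys f. if \<alpha> = m then Poly_Mapping.lookup f m else 0)"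
    unfolding dehomogenize_def lookup_sum lookup_single when_def
    by (intro sum.cong refl) (auto simp: eq)
  also have "\<dots> = Poly_Mapping.lookup f m"
    by (simp add: in_keys_iff)
  finally show "Poly_Mapping.lookup (dehomogenize i f) (Poly_Mapping.update i 0 m) = 1"
    using f by (simp add: leading_def)
next
  fix \<beta> assume \<beta>: "\<beta> \<in> Poly_Mapping.keys (dehomogenize i f)" "\<beta> \<noteq> Poly_Mapping.update i 0 m"
  then obtain \<alpha> where "\<alpha> \<in> Poly_Mapping.keys f" "\<beta> = Poly_Mapping.update i 0 \<alpha>"
    using keys_dehomogenize[of i f] by blast
  then show "W \<beta> < W (Poly_Mapping.update i 0 m)"
    using \<beta>(2) f by (auto simp: W leading_def)
qed

section \<open>The family with arbitrary coefficients\<close>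

text \<open>Free coefficients on all terms but the leading one give a single object for every
  purpose: all 1 yields F_r, powers of t the family, their values at a point a fibre, and all 0 the
  monomial.\<close>

definition twisted_F :: "nat \<Rightarrow> nat \<Rightarrow> (nat \<Rightarrow> 'k) \<Rightarrow> 'k::comm_ring_1 mpol" where
  "twisted_F N r c = pvar r * pvar (N - r) +
     (\<Sum>j=1..r. (-1) ^ j * const (c j) * pvar (r - j) * pvar (N - r + j))"

definition twisted_H :: "nat \<Rightarrow> (nat \<Rightarrow> nat \<Rightarrow> 'k) \<Rightarrow> 'k::comm_ring_1 mpol" where
  "twisted_H n c = pvar 0 * pvar (2 * n - 1) * (\<Prod>r=1..n-1. twisted_F (2 * n - 1) r (c r))"

lemma pvar_mult:
  "pvar i * pvar j = (Poly_Mapping.single (Poly_Mapping.single i 1 + Poly_Mapping.single j 1) 1 :: 'k::comm_ring_1 mpol)"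
  by (simp add: pvar_def mult_single)

text \<open>As a single monomial, each summand has an evident support, degree and
  specialization.\<close>

lemma signed_term:
  "(-1) ^ j * const c * pvar a * pvar b =
    (Poly_Mapping.single (Poly_Mapping.single a 1 + Poly_Mapping.single b 1) ((-1) ^ j * c) :: 'k::comm_ring_1 mpol)"
  by (cases "even j") (simp_all add: mult.assoc pvar_mult, simp_all add: const_def mult_single flip: single_uminus)

lemma twisted_F_1: "twisted_F N r (\<lambda>_. 1) = F N r"
  by (simp add: twisted_F_def F_def sum.atLeast_Suc_atMost const_def)

lemma twisted_H_1: "twisted_H n (\<lambda>_ _. 1) = H n"
  by (simp add: twisted_H_def H_def Let_def twisted_F_1)

lemma H_family_eq: "H_family n = twisted_H n (\<lambda>r j. [:0, 1:] ^ (2 * j * (2 * n - 1 - 2 * r + j)))"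
  by (simp add: twisted_H_def twisted_F_def H_family_def Let_def)

lemma specialize_twisted_H: "specialize t (twisted_H n c) = twisted_H n (\<lambda>r j. poly (c r j) t)"
  unfolding twisted_H_def twisted_F_def signed_term pvar_mult specialize_mult specialize_prod
    specialize_add specialize_sum specialize_single
  by (simp add: poly_power)

text \<open>The bound 1 <= j is what matters at t = 0, where only positive powers of t
  vanish.\<close>

lemma twisted_H_cong:
  "(\<And>r j. 1 \<le> r \<Longrightarrow> r \<le> n - 1 \<Longrightarrow> 1 \<le> j \<Longrightarrow> j \<le> r \<Longrightarrow> c r j = d r j) \<Longrightarrow> twisted_H n c = twisted_H n d"
  unfolding twisted_H_def twisted_F_def
  by (intro arg_cong2[of _ _ _ _ "(*)"] arg_cong2[of _ _ _ _ "(+)"] prod.cong sum.cong refl) auto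

text \<open>N is odd, so i \<mapsto> N - i exchanges the lower half of the indices with the upper
  half. Applied to unit exponent vectors, this turns the product of the p_r p_(N-r) into the product
  of all variables.\<close>

lemma sum_symmetric_pairs:
  fixes f :: "nat \<Rightarrow> 'a::comm_monoid_add"
  assumes "n \<ge> 1" "N = 2 * n - 1"
  shows "f 0 + f N + (\<Sum>r=1..n-1. f r + f (N - r)) = (\<Sum>i=0..N. f i)"
proof -
  have "(\<Sum>i=n..<2*n. f i) = (\<Sum>i<n. f (N - i))"
    using assms by (intro sum.reindex_bij_witness[of _ "\<lambda>i. N - i" "\<lambda>i. N - i"]) auto
  moreover have "(\<Sum>i=0..N. f i) = (\<Sum>i\<in>{..<n} \<union> {n..<2*n}. f i)"
    using assms by (intro sum.cong) auto
  ultimately have "(\<Sum>i=0..N. f i) = (\<Sum>i<n. f i + f (N - i))"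
    by (subst (asm) sum.union_disjoint) (auto simp: sum.distrib)
  also have "{..<n} = insert 0 {1..n-1}"
    using assms by auto
  finally show ?thesis
    by simp
qed

lemma prod_pvar: "finite I \<Longrightarrow> (\<Prod>i\<in>I. pvar i) =
    (Poly_Mapping.single (\<Sum>i\<in>I. Poly_Mapping.single i 1) 1 :: 'k::comm_ring_1 mpol)"
  by (induction I rule: finite_induct) (simp_all add: pvar_def mult_single)

lemma leading_twisted_F:
  assumes "\<And>j. 1 \<le> j \<Longrightarrow> j \<le> r \<Longrightarrow>
    W (Poly_Mapping.single (r - j) 1 + Poly_Mapping.single (N - r + j) 1) <
    W (Poly_Mapping.single r 1 + Poly_Mapping.single (N - r) 1)"
  shows "leading W (twisted_F N r c) (Poly_Mapping.single r 1 + Poly_Mapping.single (N - r) 1)"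
  unfolding twisted_F_def pvar_mult
proof (rule leading_add[OF leading_single])
  fix \<alpha> assume "\<alpha> \<in> Poly_Mapping.keys (\<Sum>j=1..r. (-1) ^ j * const (c j) * pvar (r - j) * pvar (N - r + j))"
  from subsetD[OF keys_sum this] obtain j where j: "j \<in> {1..r}"
    and "\<alpha> \<in> Poly_Mapping.keys ((-1) ^ j * const (c j) * pvar (r - j) * pvar (N - r + j))"
    by (elim UN_E)
  then have "\<alpha> = Poly_Mapping.single (r - j) 1 + Poly_Mapping.single (N - r + j) 1"
    by (auto simp: signed_term split: if_splits)
  then show "W \<alpha> < W (Poly_Mapping.single r 1 + Poly_Mapping.single (N - r) 1)"
    using assms[of j] j by simp
qed

lemma leading_twisted_H:
  assumes W: "\<And>\<alpha> \<beta>. W (\<alpha> + \<beta>) = W \<alpha> + W \<beta>"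
    and n: "n \<ge> 1" "N = 2 * n - 1"
    and less: "\<And>r j. 1 \<le> r \<Longrightarrow> r \<le> n - 1 \<Longrightarrow> 1 \<le> j \<Longrightarrow> j \<le> r \<Longrightarrow>
      W (Poly_Mapping.single (r - j) 1 + Poly_Mapping.single (N - r + j) 1) <
      W (Poly_Mapping.single r 1 + Poly_Mapping.single (N - r) 1)"
  shows "leading W (twisted_H n c) (\<Sum>i=0..N. Poly_Mapping.single i 1)"
proof -
  have "leading W (twisted_H n c) (Poly_Mapping.single 0 1 + Poly_Mapping.single N 1 +
      (\<Sum>r=1..n-1. Poly_Mapping.single r 1 + Poly_Mapping.single (N - r) 1))"
    unfolding twisted_H_def pvar_mult n(2)[symmetric] using less
    by (intro leading_mult[OF W] leading_prod[OF W] leading_single leading_twisted_F) auto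
  then show ?thesis
    using sum_symmetric_pairs[OF n, of "\<lambda>i. Poly_Mapping.single i (1::nat)"] by (simp only:)
qed

lemma twisted_H_0: "n \<ge> 1 \<Longrightarrow> twisted_H n (\<lambda>_ _. 0) = (\<Prod>i=0..2*n-1. pvar i)"
proof -
  assume n: "n \<ge> 1"
  have "twisted_H n (\<lambda>_ _. 0) = pvar 0 * pvar (2 * n - 1) * (\<Prod>r=1..n-1. pvar r * pvar (2 * n - 1 - r))"
    by (simp add: twisted_H_def twisted_F_def const_def)
  also have "(\<Prod>r=1..n-1. pvar r * pvar (2 * n - 1 - r)) = (Poly_Mapping.single
      (\<Sum>r=1..n-1. Poly_Mapping.single r 1 + Poly_Mapping.single (2 * n - 1 - r) 1) 1 :: 'a mpol)"
    unfolding pvar_mult by (induction rule: finite_induct[OF finite_atLeastAtMost]) (simp_all add: mult_single)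
  finally show ?thesis
    unfolding pvar_mult mult_single using sum_symmetric_pairs[OF n refl, of "\<lambda>i. Poly_Mapping.single i (1::nat)"]
    by (simp add: prod_pvar)
qed

section \<open>Variables and degree of the family\<close>

lemma twisted_F_carrier: "r \<le> N \<Longrightarrow> twisted_F N r c \<in> carrier (mpol_ring {..N})"
  unfolding twisted_F_def signed_term pvar_mult
  by (intro mpol_ring_closed mpol_ring_sum) (auto simp: keys_exponent_add)

lemma twisted_H_carrier: "twisted_H n c \<in> carrier (mpol_ring {..2 * n - 1})"
  unfolding twisted_H_def by (intro mpol_ring_closed mpol_ring_prod twisted_F_carrier) auto

lemma homogeneous_twisted_F: "homogeneous 2 (twisted_F N r c)"
  unfolding twisted_F_def signed_term pvar_mult
  by (intro homogeneous_add homogeneous_sum homogeneous_single) (simp_all add: weight_add)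

lemma homogeneous_twisted_H: "homogeneous (2 + (\<Sum>r=1..n-1. 2)) (twisted_H n c)"
  unfolding twisted_H_def pvar_mult
  by (intro homogeneous_mult homogeneous_prod homogeneous_twisted_F homogeneous_single) (simp add: weight_add)

text \<open>Each pair r, N - r with r < n gets total weight 2r, a strictly increasing choice that
  splits evenly. It is split evenly except on the pair of i, where i gets 0 and its partner
  everything. Oddness of N keeps i and N - i apart.\<close>

definition chart_weight :: "nat \<Rightarrow> nat \<Rightarrow> nat \<Rightarrow> nat" where
  "chart_weight N i j = (if j = i then 0 else if j = N - i then 2 * min i (N - i) else min j (N - j))"

lemma chart_weight_pair:
  assumes "i \<le> N" "N = 2 * n - 1" "r < n"
  shows "chart_weight N i r + chart_weight N i (N - r) = 2 * r"
  using assms unfolding chart_weight_def by (auto simp: min_def)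

lemma leading_chart_weight:
  assumes "n \<ge> 1" "N = 2 * n - 1" "i \<le> N"
  shows "leading (\<lambda>\<alpha>. int (weight (chart_weight N i) \<alpha>)) (twisted_H n c) (\<Sum>i=0..N. Poly_Mapping.single i 1)"
proof (rule leading_twisted_H)
  fix r j assume "1 \<le> r" "r \<le> n - 1" "1 \<le> j" "j \<le> r"
  \<comment> \<open>Rewritten in this way, the j-th term is again a symmetric pair, of total weight
    2(r - j) < 2r.\<close>
  moreover from this have "N - r + j = N - (r - j)"
    using assms by auto
  ultimately show "int (weight (chart_weight N i) (Poly_Mapping.single (r - j) 1 + Poly_Mapping.single (N - r + j) 1)) <
      int (weight (chart_weight N i) (Poly_Mapping.single r 1 + Poly_Mapping.single (N - r) 1))"
    using chart_weight_pair[OF assms(3,2), of r] chart_weight_pair[OF assms(3,2), of "r - j"] assms(1)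
    by (simp add: weight_add)
qed (use assms in \<open>simp_all add: weight_add\<close>)

text \<open>On the affine cone any of the chart weights isolates the product of the variables; index
  0 selects one.\<close>

lemma flat_twisted_H_quotient:
  fixes c :: "nat \<Rightarrow> nat \<Rightarrow> 'k::comm_ring_1"
  assumes "n \<ge> 1" "N = 2 * n - 1"
  shows "flat_module TYPE('a) TYPE('b) (ring_of_type_algebra :: 'k ring)
    (quotient_module {..N} (PIdl\<^bsub>mpol_ring {..N}\<^esub> (twisted_H n c)))"
  using twisted_H_carrier[of n c] assms
  by (intro flat_quotient_module[OF _ _ leading_chart_weight[OF assms, of 0]]) (auto simp: weight_add)

lemma flat_twisted_H_chart:
  fixes c :: "nat \<Rightarrow> nat \<Rightarrow> 'k::comm_ring_1"
  assumes "n \<ge> 1" "N = 2 * n - 1" "i \<le> N"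
  shows "flat_module TYPE('a) TYPE('b) (ring_of_type_algebra :: 'k ring)
    (quotient_module (chart_vars N i) (hypersurface N (twisted_H n c) i))"
proof -
  \<comment> \<open>The weight vanishes at i, so it does not notice that p_i is set to 1.\<close>
  have "leading (\<lambda>\<alpha>. int (weight (chart_weight N i) \<alpha>)) (dehomogenize i (twisted_H n c))
      (Poly_Mapping.update i 0 (\<Sum>i=0..N. Poly_Mapping.single i 1))"
    using leading_chart_weight[OF assms]
    by (intro leading_dehomogenize) (simp_all add: weight_update chart_weight_def)
  moreover have "dehomogenize i (twisted_H n c) \<in> carrier (mpol_ring (chart_vars N i))"
    using twisted_H_carrier[of n c] assms(2) by (intro dehomogenize_carrier) simp
  ultimately have "flat_module TYPE('a) TYPE('b) (ring_of_type_algebra :: 'k ring)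
      (quotient_module (chart_vars N i) (PIdl\<^bsub>mpol_ring (chart_vars N i)\<^esub> (dehomogenize i (twisted_H n c))))"
    by (intro flat_quotient_module) (auto simp: weight_add)
  then show ?thesis
    using assms(3) by (simp add: hypersurface_def)
qed

text \<open>The leading coefficient 1 keeps the equation nonzero for every choice of c, so neither
  the total space nor any fibre degenerates to the whole projective space.\<close>

lemma effective_divisor_twisted_H:
  assumes "n \<ge> 1" "N = 2 * n - 1"
  shows "effective_divisor N (hypersurface N (twisted_H n c))"
proof -
  have "twisted_H n c \<noteq> 0"
    using leading_chart_weight[OF assms, of 0 c] by (auto simp: leading_def)
  then show ?thesis
    using twisted_H_carrier[of n c] homogeneous_twisted_H[of n c] assms(2)
    unfolding effective_divisor_def by auto
qed

text \<open>With a = r - j and b = N - r the two weights differ by 2j(b - a) = 2j(N - 2r + j), which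
  is exactly the exponent of t in \<open>H_family\<close>. It is positive because r <= n - 1 gives a
  < b.\<close>

lemma square_weight_less:
  assumes "r \<le> n - 1" "1 \<le> j" "j \<le> r" "N = 2 * n - 1"
  shows "- int (weight (\<lambda>i. i ^ 2) (Poly_Mapping.single (r - j) 1 + Poly_Mapping.single (N - r + j) 1)) <
    - int (weight (\<lambda>i. i ^ 2) (Poly_Mapping.single r 1 + Poly_Mapping.single (N - r) 1))"
proof -
  define a where "a = r - j"
  define b where "b = N - r"
  have r: "r = a + j" and ab: "a < b"
    using assms by (auto simp: a_def b_def)
  have "2 * a * j < 2 * b * j"
    using ab assms(2) by simp
  then have "(a + j)\<^sup>2 + b\<^sup>2 < a\<^sup>2 + (b + j)\<^sup>2"
    unfolding power2_sum by linarith
  then have "r\<^sup>2 + b\<^sup>2 < a\<^sup>2 + (b + j)\<^sup>2"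
    unfolding r .
  then have "r\<^sup>2 + (N - r)\<^sup>2 < (r - j)\<^sup>2 + (N - r + j)\<^sup>2"
    by (simp only: a_def b_def)
  then show ?thesis
    by (simp only: weight_add weight_single mult_1_right neg_less_iff_less of_nat_less_iff)
qed

theorem mainTheorem4:
  fixes n N :: nat and \<omega> :: "nat \<Rightarrow> nat"
  assumes "n \<ge> 2" and "N = 2 * n - 1" and "\<omega> = (\<lambda>i. i ^ 2)"
  shows
    "(\<forall>r\<in>{1..n-1}. initial_monomials \<omega> (F N r) =
        {Poly_Mapping.single r 1 + Poly_Mapping.single (N - r) 1}) \<and>
     initial_form \<omega> (H n) = (\<Prod>i=0..N. pvar i) \<and>
     specialize 1 (H_family n) = H n \<and>
     specialize 0 (H_family n) = (\<Prod>i=0..N. pvar i) \<and>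
     flat_module TYPE('a) TYPE('b) Ct
       (quotient_module {..N} (PIdl\<^bsub>mpol_ring {..N}\<^esub> (H_family n))) \<and>
     flat_degeneration TYPE('a) TYPE('b) N (hypersurface N (H_family n))
       (hypersurface N (H n)) (hypersurface N (\<Prod>i=0..N. pvar i))"
proof (intro conjI ballI)
  have n: "n \<ge> 1"
    using assms(1) by simp
  note less = square_weight_less[OF _ _ _ assms(2), folded assms(3)]
  show "initial_monomials \<omega> (F N r) = {Poly_Mapping.single r 1 + Poly_Mapping.single (N - r) 1}"
    if "r \<in> {1..n-1}" for r
    unfolding twisted_F_1[symmetric] using that less
    by (intro leading_unique_extremum(1) leading_twisted_F) simp
  have "leading (\<lambda>\<alpha>. - int (weight \<omega> \<alpha>)) (H n) (\<Sum>i=0..N. Poly_Mapping.single i 1)"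
    unfolding twisted_H_1[symmetric] by (rule leading_twisted_H[OF _ n assms(2) less]) (simp_all add: weight_add)
  then show "initial_form \<omega> (H n) = (\<Prod>i=0..N. pvar i)"
    by (simp add: leading_unique_extremum(2) prod_pvar)
  show at_1: "specialize 1 (H_family n) = H n"
    unfolding H_family_eq specialize_twisted_H by (simp add: poly_power twisted_H_1)
  \<comment> \<open>For j >= 1 both factors of the exponent 2j(N - 2r + j) are positive, hence each
    power of t vanishes at 0.\<close>
  have "specialize 0 (H_family n) = twisted_H n (\<lambda>_ _. 0)"
    unfolding H_family_eq specialize_twisted_H by (rule twisted_H_cong) (simp add: poly_power)
  then show at_0: "specialize 0 (H_family n) = (\<Prod>i=0..N. pvar i)"
    using twisted_H_0[OF n] assms(2) by simp
  show "flat_module TYPE('a) TYPE('b) Ct (quotient_module {..N} (PIdl\<^bsub>mpol_ring {..N}\<^esub> (H_family n)))"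
    unfolding H_family_eq by (rule flat_twisted_H_quotient[OF n assms(2)])
  show "flat_degeneration TYPE('a) TYPE('b) N (hypersurface N (H_family n))
      (hypersurface N (H n)) (hypersurface N (\<Prod>i=0..N. pvar i))"
    unfolding flat_degeneration_def flat_over_line_def fibre_hypersurface at_1 at_0
    \<comment> \<open>The fibre over every c is again a \<open>twisted_H\<close>, so one lemma
      covers the divisor conditions for the total space and all fibres.\<close>
    unfolding H_family_eq specialize_twisted_H
    by (intro conjI allI impI refl effective_divisor_twisted_H[OF n assms(2)] flat_twisted_H_chart[OF n assms(2)])
qed

end
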